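(* Let $\Sigma$ be an arbitrary group and let $K$ be a difference closed field (with respect to $\Sigma$). Then, for every natural number $n$ and every perfect difference ideal $\mathfrak t\subseteq K\{y_1,\dots,y_n\}$, the equality $\mathfrak t=I(V(\mathfrak t))$ holds.
   Context: Fix a group $\Sigma$. A difference ring is a commutative associative ring with $1$ on which $\Sigma$ acts by ring automorphisms; a difference field (difference integral domain) is a difference ring that is a field (integral domain). A difference ideal is an ideal $\mathfrak a$ with $\sigma(\mathfrak a)\subseteq\mathfrak a$ for all $\sigma\in\Sigma$. A difference ideal $\mathfrak a$ of $A$ is perfect if for all $a\in A$, $r\ge 1$, $\tau_1,\dots,\tau_r\in\Sigma$ and positive integers $k_1,\dots,k_r$, $\tau_1(a)^{k_1}\cdots\tau_r(a)^{k_r}\in\mathfrak a$ implies $a\in\mathfrak a$. For a difference ring $A$ and a set $Y$, the ring of difference polynomials $A\{Y\}$ is the polynomial ring over $A$ in the variables $\sigma y$ ($\sigma\in\Sigma$, $y\in Y$), with $\Sigma$ acting on $A$ as given and on variables by $\sigma(\tau y)=(\sigma\tau)y$. If $B$ is a difference ring containing $A$ as a difference subring, $f\in A\{Y\}$ is evaluated at a point $b\in B^Y$ by substituting $\sigma(b_y)$ for $\sigma y$; $b$ is a common zero of $E\subseteq A\{Y\}$ if all $f\in E$ vanish at $b$. For $E\subseteq A\{Y\}$, $V(E)\subseteq A^Y$ is the set of all common zeros of $E$ in $A^Y$; for $X\subseteq A^Y$, $I(X)\subseteq A\{Y\}$ is the set of all difference polynomials vanishing at every point of $X$. A difference field $A$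 is called difference closed if it satisfies the following two conditions (which are equivalent for difference integral domains): (B1) for every natural number $n$ and every proper perfect difference ideal $\mathfrak a\subseteq A\{y_1,\dots,y_n\}$, there exists a common zero for $\mathfrak a$ in $A^n$; (B2) for every natural number $n$ and every subset $E\subseteq A\{y_1,\dots,y_n\}$, if there is a common zero for $E$ in $B^n$, where $B$ is a difference integral domain containing $A$, then there is a common zero for $E$ in $A^n$. *)

theory Defs
  imports
    "HOL-Library.Poly_Mapping"
    "HOL-Algebra.Group_Action"
    "HOL-Algebra.QuotRing"
    "HOL-Algebra.Algebraic_Closure_Type"
begin

section \<open>Difference rings\<close>

text \<open>The group \<open>\<Sigma>\<close> is \<open>G\<close>. The library's notion of a group action makes each \<open>\<phi> g\<close>
  \<open>undefined\<close> outside the carrier; this is only a convention about irrelevant values.\<close>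

definition difference_ring ::
    "('g, 'm) monoid_scheme \<Rightarrow> ('b, 'r) ring_scheme \<Rightarrow> ('g \<Rightarrow> 'b \<Rightarrow> 'b) \<Rightarrow> bool" where
  "difference_ring G R \<phi> \<longleftrightarrow>
     cring R \<and> group_action G (carrier R) \<phi> \<and> (\<forall>g\<in>carrier G. \<phi> g \<in> ring_hom R R)"

definition difference_ideal ::
    "('g, 'm) monoid_scheme \<Rightarrow> ('b, 'r) ring_scheme \<Rightarrow> ('g \<Rightarrow> 'b \<Rightarrow> 'b) \<Rightarrow> 'b set \<Rightarrow> bool" where
  "difference_ideal G R \<phi> \<aa> \<longleftrightarrow> ideal \<aa> R \<and> (\<forall>g\<in>carrier G. \<phi> g ` \<aa> \<subseteq> \<aa>)"

definition perfect_difference_ideal ::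
    "('g, 'm) monoid_scheme \<Rightarrow> ('b, 'r) ring_scheme \<Rightarrow> ('g \<Rightarrow> 'b \<Rightarrow> 'b) \<Rightarrow> 'b set \<Rightarrow> bool" where
  "perfect_difference_ideal G R \<phi> \<aa> \<longleftrightarrow> difference_ideal G R \<phi> \<aa> \<and>
     (\<forall>a\<in>carrier R. \<forall>r::nat. \<forall>\<tau> :: nat \<Rightarrow> 'g. \<forall>k :: nat \<Rightarrow> nat.
        1 \<le> r \<and> (\<forall>i\<in>{1..r}. \<tau> i \<in> carrier G \<and> 0 < k i) \<and>
        (\<Otimes>\<^bsub>R\<^esub>i\<in>{1..r}. \<phi> (\<tau> i) a [^]\<^bsub>R\<^esub> k i) \<in> \<aa> \<longrightarrow> a \<in> \<aa>)"

section \<open>Difference polynomials\<close>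

text \<open>The pair \<open>(g, y)\<close> stands for the variable \<open>g y\<close>; a monomial is a finitely supported
  exponent function on such pairs, and a polynomial a finitely supported function from
  monomials to coefficients, multiplied by convolution.\<close>

type_synonym ('g, 'y, 'a) dpoly = "(('g \<times> 'y) \<Rightarrow>\<^sub>0 nat) \<Rightarrow>\<^sub>0 'a"

definition dpoly_ring ::
    "('g, 'm) monoid_scheme \<Rightarrow> 'y set \<Rightarrow> ('g, 'y, 'a::comm_ring_1) dpoly ring" where
  "dpoly_ring G Y =
     \<lparr>carrier = {p. \<forall>m\<in>Poly_Mapping.keys p. Poly_Mapping.keys m \<subseteq> carrier G \<times> Y},
      monoid.mult = (*), one = 1, ring.zero = 0, add = (+)\<rparr>"

definition shift_monomial ::
    "('g, 'm) monoid_scheme \<Rightarrow> 'g \<Rightarrow> (('g \<times> 'y) \<Rightarrow>\<^sub>0 nat) \<Rightarrow> (('g \<times> 'y) \<Rightarrow>\<^sub>0 nat)" where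
  "shift_monomial G g m =
     (\<Sum>v\<in>Poly_Mapping.keys m. Poly_Mapping.single (g \<otimes>\<^bsub>G\<^esub> fst v, snd v) (Poly_Mapping.lookup m v))"

definition dpoly_action ::
    "('g, 'm) monoid_scheme \<Rightarrow> ('g \<Rightarrow> 'a::comm_ring_1 \<Rightarrow> 'a) \<Rightarrow> 'y set \<Rightarrow>
     'g \<Rightarrow> ('g, 'y, 'a) dpoly \<Rightarrow> ('g, 'y, 'a) dpoly" where
  "dpoly_action G \<phi> Y g =
     (\<lambda>p\<in>carrier (dpoly_ring G Y). \<Sum>m\<in>Poly_Mapping.keys p.
        Poly_Mapping.single (shift_monomial G g m) (\<phi> g (Poly_Mapping.lookup p m)))"

text \<open>A difference ring \<open>B\<close> containing \<open>A\<close> is given by an injective equivariant homomorphism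
  \<open>\<iota>\<close> from \<open>A\<close> to \<open>B\<close>.\<close>

definition difference_embedding ::
    "('g, 'm) monoid_scheme \<Rightarrow> ('a, 's) ring_scheme \<Rightarrow> ('g \<Rightarrow> 'a \<Rightarrow> 'a) \<Rightarrow>
     ('b, 'r) ring_scheme \<Rightarrow> ('g \<Rightarrow> 'b \<Rightarrow> 'b) \<Rightarrow> ('a \<Rightarrow> 'b) \<Rightarrow> bool" where
  "difference_embedding G A \<phi> B \<beta> \<iota> \<longleftrightarrow>
     \<iota> \<in> ring_hom A B \<and> inj_on \<iota> (carrier A) \<and>
     (\<forall>g\<in>carrier G. \<forall>a\<in>carrier A. \<iota> (\<phi> g a) = \<beta> g (\<iota> a))"

definition dpoly_eval ::
    "('b, 'r) ring_scheme \<Rightarrow> ('g \<Rightarrow> 'b \<Rightarrow> 'b) \<Rightarrow> ('a::comm_ring_1 \<Rightarrow> 'b) \<Rightarrow>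
     ('y \<Rightarrow> 'b) \<Rightarrow> ('g, 'y, 'a) dpoly \<Rightarrow> 'b" where
  "dpoly_eval B \<beta> \<iota> b p =
     (\<Oplus>\<^bsub>B\<^esub>m\<in>Poly_Mapping.keys p. \<iota> (Poly_Mapping.lookup p m) \<otimes>\<^bsub>B\<^esub>
        (\<Otimes>\<^bsub>B\<^esub>v\<in>Poly_Mapping.keys m. \<beta> (fst v) (b (snd v)) [^]\<^bsub>B\<^esub> Poly_Mapping.lookup m v))"

definition common_zeros ::
    "('b, 'r) ring_scheme \<Rightarrow> ('g \<Rightarrow> 'b \<Rightarrow> 'b) \<Rightarrow> ('a::comm_ring_1 \<Rightarrow> 'b) \<Rightarrow> 'y set \<Rightarrow>
     ('g, 'y, 'a) dpoly set \<Rightarrow> ('y \<Rightarrow> 'b) set" where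
  "common_zeros B \<beta> \<iota> Y E =
     {b \<in> Y \<rightarrow>\<^sub>E carrier B. \<forall>f\<in>E. dpoly_eval B \<beta> \<iota> b f = \<zero>\<^bsub>B\<^esub>}"

definition zero_set ::
    "('g \<Rightarrow> 'a::comm_ring_1 \<Rightarrow> 'a) \<Rightarrow> 'y set \<Rightarrow> ('g, 'y, 'a) dpoly set \<Rightarrow> ('y \<Rightarrow> 'a) set" where
  "zero_set \<phi> Y E = common_zeros ring_of_type_algebra \<phi> id Y E"

definition vanishing_ideal ::
    "('g, 'm) monoid_scheme \<Rightarrow> ('g \<Rightarrow> 'a::comm_ring_1 \<Rightarrow> 'a) \<Rightarrow> 'y set \<Rightarrow>
     ('y \<Rightarrow> 'a) set \<Rightarrow> ('g, 'y, 'a) dpoly set" where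
  "vanishing_ideal G \<phi> Y S =
     {f \<in> carrier (dpoly_ring G Y). \<forall>b\<in>S. dpoly_eval ring_of_type_algebra \<phi> id b f = 0}"

section \<open>Difference closed fields\<close>

definition difference_closed_B1 ::
    "('g, 'm) monoid_scheme \<Rightarrow> ('g \<Rightarrow> 'a::comm_ring_1 \<Rightarrow> 'a) \<Rightarrow> bool" where
  "difference_closed_B1 G \<phi> \<longleftrightarrow>
     (\<forall>(n::nat) (\<aa> :: ('g, nat, 'a) dpoly set).
        perfect_difference_ideal G (dpoly_ring G {1..n}) (dpoly_action G \<phi> {1..n}) \<aa> \<and>
        \<aa> \<noteq> carrier (dpoly_ring G {1..n}) \<longrightarrow>
        zero_set \<phi> {1..n} \<aa> \<noteq> {})"

definition difference_closed_B2_over ::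
    "'b itself \<Rightarrow> ('g, 'm) monoid_scheme \<Rightarrow> ('g \<Rightarrow> 'a::comm_ring_1 \<Rightarrow> 'a) \<Rightarrow> bool" where
  "difference_closed_B2_over _ G \<phi> \<longleftrightarrow>
     (\<forall>(n::nat) (E :: ('g, nat, 'a) dpoly set) (B :: 'b ring) \<beta> \<iota>.
        E \<subseteq> carrier (dpoly_ring G {1..n}) \<and>
        difference_ring G B \<beta> \<and> domain B \<and>
        difference_embedding G ring_of_type_algebra \<phi> B \<beta> \<iota> \<and>
        common_zeros B \<beta> \<iota> {1..n} E \<noteq> {} \<longrightarrow>
        zero_set \<phi> {1..n} E \<noteq> {})"

text \<open>HOL cannot quantify over all types inside a definition, so \<open>B\<close> ranges over the difference
  domains whose elements are sets of difference polynomials. This loses nothing: a zero \<open>b\<close> in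
  an arbitrary \<open>B\<close> lies in the difference subring generated by \<open>A\<close> and \<open>b\<close>, which is
  isomorphic to a quotient of the ring of difference polynomials
  (lemma \<open>difference_closed_B2_universal\<close> below).\<close>

definition difference_closed_B2 ::
    "('g, 'm) monoid_scheme \<Rightarrow> ('g \<Rightarrow> 'a::comm_ring_1 \<Rightarrow> 'a) \<Rightarrow> bool" where
  "difference_closed_B2 G \<phi> \<longleftrightarrow>
     difference_closed_B2_over TYPE(('g, nat, 'a) dpoly set) G \<phi>"

definition difference_closed_field ::
    "('g, 'm) monoid_scheme \<Rightarrow> ('g \<Rightarrow> 'a::field \<Rightarrow> 'a) \<Rightarrow> bool" where
  "difference_closed_field G \<phi> \<longleftrightarrow>
     difference_ring G (ring_of_type_algebra :: 'a ring) \<phi> \<and>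
     difference_closed_B1 G \<phi> \<and> difference_closed_B2 G \<phi>"

section \<open>The ring of difference polynomials is a difference ring\<close>

abbreviation monomials :: "('g, 'm) monoid_scheme \<Rightarrow> 'y set \<Rightarrow> (('g \<times> 'y) \<Rightarrow>\<^sub>0 nat) set" where
  "monomials G Y \<equiv> {m. Poly_Mapping.keys m \<subseteq> carrier G \<times> Y}"

lemma dpoly_ring_simps:
  "carrier (dpoly_ring G Y) = {p. Poly_Mapping.keys p \<subseteq> monomials G Y}"
  "monoid.mult (dpoly_ring G Y) = (*)" "one (dpoly_ring G Y) = 1"
  "ring.zero (dpoly_ring G Y) = 0" "add (dpoly_ring G Y) = (+)"
  by (auto simp: dpoly_ring_def)

lemma monomials_add: "m \<in> monomials G Y \<Longrightarrow> m' \<in> monomials G Y \<Longrightarrow> m + m' \<in> monomials G Y"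
  using Poly_Mapping.keys_add[of m m'] by blast

lemma dpoly_closed_add:
  "p \<in> carrier (dpoly_ring G Y) \<Longrightarrow> q \<in> carrier (dpoly_ring G Y) \<Longrightarrow> p + q \<in> carrier (dpoly_ring G Y)"
  using Poly_Mapping.keys_add[of p q] by (force simp: dpoly_ring_simps)

lemma dpoly_closed_mult:
  assumes "p \<in> carrier (dpoly_ring G Y)" "q \<in> carrier (dpoly_ring G Y)"
  shows "p * q \<in> carrier (dpoly_ring G Y)"
proof -
  have "Poly_Mapping.keys (p * q) \<subseteq> {a + b | a b. a \<in> Poly_Mapping.keys p \<and> b \<in> Poly_Mapping.keys q}"
    by (rule Poly_Mapping.keys_mult)
  also have "\<dots> \<subseteq> monomials G Y"
    using assms monomials_add[of _ G Y] unfolding dpoly_ring_simps by blast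
  finally show ?thesis by (simp add: dpoly_ring_simps)
qed

lemma dpoly_closed_single: "m \<in> monomials G Y \<Longrightarrow> Poly_Mapping.single m c \<in> carrier (dpoly_ring G Y)"
  by (simp add: dpoly_ring_simps)

lemma dpoly_closed_uminus: "p \<in> carrier (dpoly_ring G Y) \<Longrightarrow> - p \<in> carrier (dpoly_ring G Y)"
  by (simp add: dpoly_ring_simps subset_iff in_keys_iff)

lemma dpoly_closed_0_1: "0 \<in> carrier (dpoly_ring G Y)" "1 \<in> carrier (dpoly_ring G Y)"
  by (simp_all add: dpoly_ring_simps)

lemma dpoly_ring_cring: "cring (dpoly_ring G Y)"
proof (rule cringI)
  show "abelian_group (dpoly_ring G Y)"
  proof (rule abelian_groupI)
    fix p assume "p \<in> carrier (dpoly_ring G Y)"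
    then show "\<exists>q\<in>carrier (dpoly_ring G Y). q \<oplus>\<^bsub>dpoly_ring G Y\<^esub> p = \<zero>\<^bsub>dpoly_ring G Y\<^esub>"
      by (intro bexI[of _ "- p"]) (auto simp: dpoly_closed_uminus dpoly_ring_simps(2-))
  qed (auto simp: dpoly_closed_add dpoly_closed_0_1 dpoly_ring_simps(2-) algebra_simps)
  show "comm_monoid (dpoly_ring G Y)"
    by (rule comm_monoidI)
      (auto simp: dpoly_closed_mult dpoly_closed_0_1 dpoly_ring_simps(2-) algebra_simps)
qed (auto simp: dpoly_ring_simps(2-) algebra_simps)

lemma poly_mapping_sum_single:
  "(p :: 'x \<Rightarrow>\<^sub>0 'c::comm_monoid_add) =
     (\<Sum>m\<in>Poly_Mapping.keys p. Poly_Mapping.single m (Poly_Mapping.lookup p m))"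
  by (rule poly_mapping_eqI) (auto simp: lookup_sum lookup_single when_def in_keys_iff)

lemma poly_mapping_induct [consumes 1, case_names zero single add]:
  fixes p :: "'x \<Rightarrow>\<^sub>0 'c::comm_monoid_add"
  assumes p: "Poly_Mapping.keys p \<subseteq> M"
    and z: "P 0"
    and s: "\<And>m c. m \<in> M \<Longrightarrow> P (Poly_Mapping.single m c)"
    and a: "\<And>p q. Poly_Mapping.keys p \<subseteq> M \<Longrightarrow> Poly_Mapping.keys q \<subseteq> M \<Longrightarrow>
              P p \<Longrightarrow> P q \<Longrightarrow> P (p + q)"
  shows "P p"
proof -
  let ?t = "\<lambda>m. Poly_Mapping.single m (Poly_Mapping.lookup p m)"
  have "Poly_Mapping.keys (sum ?t N) \<subseteq> M \<and> P (sum ?t N)" if "N \<subseteq> Poly_Mapping.keys p" for N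
    using finite_subset[OF that finite_keys] that
  proof (induction N rule: finite_induct)
    case empty
    then show ?case using z by simp
  next
    case (insert m N)
    then have m: "m \<in> M" "Poly_Mapping.keys (?t m) \<subseteq> M" using p by auto
    have "Poly_Mapping.keys (?t m + sum ?t N) \<subseteq> M"
      using Poly_Mapping.keys_add[of "?t m" "sum ?t N"] m insert by blast
    moreover have "P (?t m + sum ?t N)"
      using insert m s[OF m(1)] by (intro a) auto
    ultimately show ?case using insert by simp
  qed
  from this[of "Poly_Mapping.keys p"] show ?thesis
    using poly_mapping_sum_single[of p] by simp
qed

lemma poly_mapping_extend_add:
  fixes f :: "'x \<Rightarrow> 'c::comm_monoid_add \<Rightarrow> 'd::comm_monoid_add"
  assumes z: "\<And>m. f m 0 = 0" and a: "\<And>m c d. f m (c + d) = f m c + f m d"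
  shows "(\<Sum>m\<in>Poly_Mapping.keys (p + q). f m (Poly_Mapping.lookup (p + q) m)) =
         (\<Sum>m\<in>Poly_Mapping.keys p. f m (Poly_Mapping.lookup p m)) +
         (\<Sum>m\<in>Poly_Mapping.keys q. f m (Poly_Mapping.lookup q m))"
proof -
  let ?N = "Poly_Mapping.keys p \<union> Poly_Mapping.keys q"
  have *: "(\<Sum>m\<in>Poly_Mapping.keys r. f m (Poly_Mapping.lookup r m)) =
          (\<Sum>m\<in>?N. f m (Poly_Mapping.lookup r m))" if "Poly_Mapping.keys r \<subseteq> ?N" for r
    using that by (intro sum.mono_neutral_left) (auto simp: in_keys_iff z)
  show ?thesis
    using *[OF Poly_Mapping.keys_add] *[of p] *[of q]
    by (simp add: lookup_add a sum.distrib)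
qed

lemma shift_monomial_add: "shift_monomial G g (m + m') = shift_monomial G g m + shift_monomial G g m'"
  unfolding shift_monomial_def by (rule poly_mapping_extend_add) (auto simp: single_add)

lemma shift_monomial_single:
  "shift_monomial G g (Poly_Mapping.single v k) = Poly_Mapping.single (g \<otimes>\<^bsub>G\<^esub> fst v, snd v) k"
  by (simp add: shift_monomial_def)

lemma shift_monomial_0: "shift_monomial G g 0 = 0"
  by (simp add: shift_monomial_def)

lemma shift_monomial_closed:
  assumes "group G" "g \<in> carrier G" "m \<in> monomials G Y"
  shows "shift_monomial G g m \<in> monomials G Y"
proof -
  interpret group G by fact
  have "Poly_Mapping.keys m \<subseteq> carrier G \<times> Y" using assms by simp
  then show ?thesis
    by (induction m rule: poly_mapping_induct)
      (use assms(2) monomials_add[of _ G Y] in \<open>auto simp: shift_monomial_add shift_monomial_single shift_monomial_0\<close>)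
qed

lemma shift_monomial_one:
  assumes "group G" "m \<in> monomials G Y"
  shows "shift_monomial G \<one>\<^bsub>G\<^esub> m = m"
proof -
  interpret group G by fact
  have "Poly_Mapping.keys m \<subseteq> carrier G \<times> Y" using assms by simp
  then show ?thesis
    by (induction m rule: poly_mapping_induct)
      (auto simp: shift_monomial_add shift_monomial_single shift_monomial_0)
qed

lemma shift_monomial_mult:
  assumes "group G" "g \<in> carrier G" "h \<in> carrier G" "m \<in> monomials G Y"
  shows "shift_monomial G (g \<otimes>\<^bsub>G\<^esub> h) m = shift_monomial G g (shift_monomial G h m)"
proof -
  interpret group G by fact
  have "Poly_Mapping.keys m \<subseteq> carrier G \<times> Y" using assms by simp
  then show ?thesis
    by (induction m rule: poly_mapping_induct)
      (use assms in \<open>auto simp: shift_monomial_add shift_monomial_single shift_monomial_0 m_assoc\<close>)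
qed

lemma difference_ringI:
  assumes G: "group G" and R: "cring R"
    and hom: "\<And>g. g \<in> carrier G \<Longrightarrow> \<phi> g \<in> ring_hom R R"
    and ext: "\<And>g. g \<in> carrier G \<Longrightarrow> \<phi> g \<in> extensional (carrier R)"
    and one: "\<And>x. x \<in> carrier R \<Longrightarrow> \<phi> \<one>\<^bsub>G\<^esub> x = x"
    and mult: "\<And>g h x. g \<in> carrier G \<Longrightarrow> h \<in> carrier G \<Longrightarrow> x \<in> carrier R \<Longrightarrow>
                 \<phi> (g \<otimes>\<^bsub>G\<^esub> h) x = \<phi> g (\<phi> h x)"
  shows "difference_ring G R \<phi>"
proof -
  interpret group G by fact
  have cl: "\<phi> g x \<in> carrier R" if "g \<in> carrier G" "x \<in> carrier R" for g x
    using ring_hom_closed[OF hom] that by blast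
  have inv: "\<phi> (inv\<^bsub>G\<^esub> g) (\<phi> g x) = x" "\<phi> g (\<phi> (inv\<^bsub>G\<^esub> g) x) = x"
    if "g \<in> carrier G" "x \<in> carrier R" for g x
    using that mult[symmetric] one by simp_all
  have bij: "\<phi> g \<in> Bij (carrier R)" if "g \<in> carrier G" for g
    unfolding Bij_def using ext[OF that]
    by (auto intro!: bij_betwI[of _ _ _ "\<phi> (inv\<^bsub>G\<^esub> g)"] simp: that cl inv)
  have "group_action G (carrier R) \<phi>"
    unfolding group_action_def group_hom_def group_hom_axioms_def
  proof (intro conjI homI)
    fix g h assume gh: "g \<in> carrier G" "h \<in> carrier G"
    have "\<phi> (g \<otimes>\<^bsub>G\<^esub> h) = compose (carrier R) (\<phi> g) (\<phi> h)"
      using gh mult ext[of "g \<otimes>\<^bsub>G\<^esub> h"] by (intro extensionalityI[of _ "carrier R"]) (auto simp: compose_eq)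
    then show "\<phi> (g \<otimes>\<^bsub>G\<^esub> h) = \<phi> g \<otimes>\<^bsub>BijGroup (carrier R)\<^esub> \<phi> h"
      using gh bij by (simp add: BijGroup_def)
  qed (auto simp: bij BijGroup_def G group_BijGroup[unfolded BijGroup_def])
  then show ?thesis
    using R hom by (simp add: difference_ring_def)
qed

lemma difference_ringD:
  assumes "difference_ring G R \<phi>"
  shows "group G" "cring R"
    and "\<And>g. g \<in> carrier G \<Longrightarrow> \<phi> g \<in> ring_hom R R"
    and "\<And>g x. g \<in> carrier G \<Longrightarrow> x \<in> carrier R \<Longrightarrow> \<phi> g x \<in> carrier R"
    and "\<And>x. x \<in> carrier R \<Longrightarrow> \<phi> \<one>\<^bsub>G\<^esub> x = x"
    and "\<And>g h x. g \<in> carrier G \<Longrightarrow> h \<in> carrier G \<Longrightarrow> x \<in> carrier R \<Longrightarrow>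
                 \<phi> (g \<otimes>\<^bsub>G\<^esub> h) x = \<phi> g (\<phi> h x)"
proof -
  interpret group_action G "carrier R" \<phi> using assms by (simp add: difference_ring_def)
  show "group G" using group_hom by (simp add: group_hom_def)
  show "cring R" and hom: "\<And>g. g \<in> carrier G \<Longrightarrow> \<phi> g \<in> ring_hom R R"
    using assms by (auto simp: difference_ring_def)
  show "\<phi> g x \<in> carrier R" if "g \<in> carrier G" "x \<in> carrier R" for g x
    using ring_hom_closed[OF hom] that by blast
  show "\<phi> \<one>\<^bsub>G\<^esub> x = x" if "x \<in> carrier R" for x
    using fun_cong[OF id_eq_one, of x] that by simp
  show "\<phi> (g \<otimes>\<^bsub>G\<^esub> h) x = \<phi> g (\<phi> h x)" if "g \<in> carrier G" "h \<in> carrier G" "x \<in> carrier R" for g h x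
    using composition_rule[of x g h] that by simp
qed

lemma ring_of_type_algebra_simps:
  "carrier ring_of_type_algebra = UNIV" "monoid.mult ring_of_type_algebra = (*)"
  "one ring_of_type_algebra = 1" "ring.zero ring_of_type_algebra = 0"
  "add ring_of_type_algebra = (+)"
  by (auto simp: ring_of_type_algebra_def fun_eq_iff)

lemma difference_ring_typeD:
  fixes \<phi> :: "'g \<Rightarrow> 'a::comm_ring_1 \<Rightarrow> 'a"
  assumes "difference_ring G ring_of_type_algebra \<phi>" and g: "g \<in> carrier G"
  shows "\<phi> g (x + y) = \<phi> g x + \<phi> g y" "\<phi> g (x * y) = \<phi> g x * \<phi> g y"
    "\<phi> g 1 = 1" "\<phi> g 0 = 0" "\<phi> \<one>\<^bsub>G\<^esub> x = x"
    "h \<in> carrier G \<Longrightarrow> \<phi> (g \<otimes>\<^bsub>G\<^esub> h) x = \<phi> g (\<phi> h x)"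
proof -
  note D = difference_ringD[OF assms(1)]
  show *: "\<phi> g (x + y) = \<phi> g x + \<phi> g y" for x y
    using ring_hom_add[OF D(3)[OF g], of x y] by (simp add: ring_of_type_algebra_simps)
  show "\<phi> g (x * y) = \<phi> g x * \<phi> g y"
    using ring_hom_mult[OF D(3)[OF g], of x y] by (simp add: ring_of_type_algebra_simps)
  show "\<phi> g 1 = 1"
    using ring_hom_one[OF D(3)[OF g]] by (simp add: ring_of_type_algebra_simps)
  show "\<phi> g 0 = 0" using *[of 0 0] by simp
  show "\<phi> \<one>\<^bsub>G\<^esub> x = x" "h \<in> carrier G \<Longrightarrow> \<phi> (g \<otimes>\<^bsub>G\<^esub> h) x = \<phi> g (\<phi> h x)"
    using D(5)[of x] D(6)[OF g, of h x] by (auto simp: ring_of_type_algebra_simps)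
qed

lemma dpoly_action_single:
  assumes "m \<in> monomials G Y" "\<phi> g 0 = 0"
  shows "dpoly_action G \<phi> Y g (Poly_Mapping.single m c) = Poly_Mapping.single (shift_monomial G g m) (\<phi> g c)"
  using assms by (auto simp: dpoly_action_def dpoly_closed_single)

lemma dpoly_action_0: "dpoly_action G \<phi> Y g 0 = 0"
  by (simp add: dpoly_action_def dpoly_closed_0_1)

lemma dpoly_action_add:
  assumes "\<And>x y. \<phi> g (x + y) = \<phi> g x + \<phi> g y" "\<phi> g 0 = 0"
    and "p \<in> carrier (dpoly_ring G Y)" "q \<in> carrier (dpoly_ring G Y)"
  shows "dpoly_action G \<phi> Y g (p + q) = dpoly_action G \<phi> Y g p + dpoly_action G \<phi> Y g q"
  using assms(3,4) dpoly_closed_add[OF assms(3,4)] unfolding dpoly_action_def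
  by (simp add: poly_mapping_extend_add
        [where f = "\<lambda>m c. Poly_Mapping.single (shift_monomial G g m) (\<phi> g c)"] assms(1,2) single_add)

lemma dpoly_ring_difference_ring:
  fixes G :: "('g, 'm) monoid_scheme" and \<phi> :: "'g \<Rightarrow> 'a::comm_ring_1 \<Rightarrow> 'a" and Y :: "'y set"
  assumes "difference_ring G ring_of_type_algebra \<phi>"
  shows "difference_ring G (dpoly_ring G Y) (dpoly_action G \<phi> Y)"
proof -
  note D = difference_ring_typeD[OF assms]
  interpret group G using difference_ringD[OF assms] by simp
  let ?P = "dpoly_ring G Y :: ('g, 'y, 'a) dpoly ring" and ?A = "dpoly_action G \<phi> Y"
  note closed = shift_monomial_closed[OF group_axioms]
  have cl: "?A g p \<in> carrier ?P" if "g \<in> carrier G" "p \<in> carrier ?P" for g p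
  proof -
    have "Poly_Mapping.keys p \<subseteq> monomials G Y" using that by (simp add: dpoly_ring_simps)
    then show ?thesis
    proof (induction p rule: poly_mapping_induct)
      case (add p q)
      then show ?case
        using dpoly_action_add[of \<phi> g p G Y q, OF D(1) D(4)] that(1)
        by (simp add: dpoly_closed_add dpoly_ring_simps(1))
          (metis (mono_tags, lifting) dpoly_closed_add dpoly_ring_simps(1) mem_Collect_eq)
    next
      case (single m c)
      then show ?case
        using dpoly_closed_single[OF closed[OF that(1) single]]
        by (simp add: dpoly_action_single D(4)[OF that(1)])
    qed (simp add: dpoly_action_0 dpoly_closed_0_1)
  qed
  show ?thesis
  proof (rule difference_ringI[OF group_axioms dpoly_ring_cring])
    fix g assume g: "g \<in> carrier G"
    show "?A g \<in> extensional (carrier ?P)" by (simp add: dpoly_action_def)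
    have mult1: "?A g (Poly_Mapping.single m c * q) = ?A g (Poly_Mapping.single m c) * ?A g q"
      if "m \<in> monomials G Y" "q \<in> carrier ?P" for m c q
    proof -
      have "Poly_Mapping.keys q \<subseteq> monomials G Y" using that by (simp add: dpoly_ring_simps)
      then show ?thesis
      proof (induction q rule: poly_mapping_induct)
        case (single m' c')
        then show ?case
          using that g monomials_add[OF that(1) single]
          by (simp add: mult_single dpoly_action_single D(4)[OF g] D(2)[OF g] shift_monomial_add)
      next
        case (add p q)
        then have pq: "p \<in> carrier ?P" "q \<in> carrier ?P" by (auto simp: dpoly_ring_simps)
        note s = dpoly_closed_single[OF that(1), of c]
        show ?case
          using add.IH dpoly_closed_mult[OF s pq(1)] dpoly_closed_mult[OF s pq(2)] pq
          by (simp add: distrib_left dpoly_action_add[of \<phi>, OF D(1)[OF g] D(4)[OF g]])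
      qed (simp add: dpoly_action_0)
    qed
    have mult: "?A g (p * q) = ?A g p * ?A g q" if "p \<in> carrier ?P" "q \<in> carrier ?P" for p q
    proof -
      have "Poly_Mapping.keys p \<subseteq> monomials G Y" using that by (simp add: dpoly_ring_simps)
      then show ?thesis
      proof (induction p rule: poly_mapping_induct)
        case (single m c)
        then show ?case using mult1 that(2) by blast
      next
        case (add p p')
        then have pq: "p \<in> carrier ?P" "p' \<in> carrier ?P" by (auto simp: dpoly_ring_simps)
        show ?case
          using add.IH dpoly_closed_mult[OF pq(1) that(2)] dpoly_closed_mult[OF pq(2) that(2)] pq
          by (simp add: distrib_right dpoly_action_add[of \<phi>, OF D(1)[OF g] D(4)[OF g]])
      qed (simp add: dpoly_action_0)
    qed
    have one: "?A g 1 = 1"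
      using dpoly_action_single[of 0 G Y \<phi> g 1] D(3,4)[OF g]
      by (simp add: shift_monomial_0)
    show "?A g \<in> ring_hom ?P ?P"
      using g cl mult one dpoly_action_add[of \<phi>, OF D(1)[OF g] D(4)[OF g]]
      by (intro ring_hom_memI) (auto simp: dpoly_ring_simps(2-))
  next
    fix p assume p: "p \<in> carrier ?P"
    then have "Poly_Mapping.keys p \<subseteq> monomials G Y" by (simp add: dpoly_ring_simps)
    then show "?A \<one>\<^bsub>G\<^esub> p = p"
    proof (induction p rule: poly_mapping_induct)
      case (single m c)
      then show ?case by (simp add: dpoly_action_single D(4,5)[OF one_closed] shift_monomial_one[OF group_axioms, of _ Y])
    next
      case (add p q)
      then show ?case
        by (simp add: dpoly_action_add[of \<phi>, OF D(1)[OF one_closed] D(4)[OF one_closed]] dpoly_ring_simps(1))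
    qed (simp add: dpoly_action_0)
  next
    fix g h p assume gh: "g \<in> carrier G" "h \<in> carrier G" and p: "p \<in> carrier ?P"
    then have "Poly_Mapping.keys p \<subseteq> monomials G Y" by (simp add: dpoly_ring_simps)
    then show "?A (g \<otimes>\<^bsub>G\<^esub> h) p = ?A g (?A h p)"
    proof (induction p rule: poly_mapping_induct)
      case (single m c)
      then show ?case
        using gh closed[OF gh(2), of m Y]
        by (simp add: dpoly_action_single D shift_monomial_mult[OF group_axioms, of _ _ _ Y])
    next
      case (add p q)
      then have pq: "p \<in> carrier ?P" "q \<in> carrier ?P" by (auto simp: dpoly_ring_simps)
      show ?case
        using add.IH cl[OF gh(2) pq(1)] cl[OF gh(2) pq(2)] pq gh m_closed[OF gh]
        by (simp add: dpoly_action_add[of \<phi>, OF D(1) D(4)])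
    qed (simp add: dpoly_action_0)
  qed
qed

section \<open>Evaluation and the choice of universe\<close>

lemma ring_hom_nat_pow:
  fixes k :: nat
  assumes "ring_hom_cring R S h" "x \<in> carrier R"
  shows "h (x [^]\<^bsub>R\<^esub> k) = h x [^]\<^bsub>S\<^esub> k"
proof -
  interpret ring_hom_cring R S h by fact
  show ?thesis using assms(2) by (induction k) auto
qed

definition monomial_eval ::
    "('b, 'r) ring_scheme \<Rightarrow> ('g \<Rightarrow> 'b \<Rightarrow> 'b) \<Rightarrow> ('y \<Rightarrow> 'b) \<Rightarrow> (('g \<times> 'y) \<Rightarrow>\<^sub>0 nat) \<Rightarrow> 'b" where
  "monomial_eval B \<beta> b m =
     (\<Otimes>\<^bsub>B\<^esub>v\<in>Poly_Mapping.keys m. \<beta> (fst v) (b (snd v)) [^]\<^bsub>B\<^esub> Poly_Mapping.lookup m v)"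

locale dpoly_evaluation =
  fixes G :: "('g, 'm) monoid_scheme" and \<phi> :: "'g \<Rightarrow> 'a::comm_ring_1 \<Rightarrow> 'a"
    and B :: "('b, 'r) ring_scheme" (structure) and \<beta> \<iota> and Y :: "'y set" and b :: "'y \<Rightarrow> 'b"
  assumes A: "difference_ring G ring_of_type_algebra \<phi>"
    and B: "difference_ring G B \<beta>"
    and hom: "\<iota> \<in> ring_hom ring_of_type_algebra B"
    and equiv: "\<And>g a. g \<in> carrier G \<Longrightarrow> \<iota> (\<phi> g a) = \<beta> g (\<iota> a)"
    and point: "\<And>y. y \<in> Y \<Longrightarrow> b y \<in> carrier B"
begin

sublocale cring B using difference_ringD[OF B] by simp
sublocale G: group G using difference_ringD[OF B] by simp

lemma \<iota>:
  "\<iota> x \<in> carrier B" "\<iota> (x + y) = \<iota> x \<oplus> \<iota> y" "\<iota> (x * y) = \<iota> x \<otimes> \<iota> y" "\<iota> 1 = \<one>" "\<iota> 0 = \<zero>"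
proof -
  have r: "ring (ring_of_type_algebra :: 'a ring)" by (rule ring_from_type_algebra)
  show "\<iota> x \<in> carrier B" "\<iota> (x + y) = \<iota> x \<oplus> \<iota> y" "\<iota> (x * y) = \<iota> x \<otimes> \<iota> y" "\<iota> 1 = \<one>" "\<iota> 0 = \<zero>"
    using ring_hom_closed[OF hom, of x] ring_hom_add[OF hom, of x y] ring_hom_mult[OF hom, of x y]
      ring_hom_one[OF hom] ring_hom_zero[OF hom r ring_axioms]
    by (simp_all add: ring_of_type_algebra_simps)
qed

lemma value_closed: "v \<in> carrier G \<times> Y \<Longrightarrow> \<beta> (fst v) (b (snd v)) \<in> carrier B"
  using difference_ringD(4)[OF B] point by auto

lemma monomial_eval_superset:
  assumes "finite V" "V \<subseteq> carrier G \<times> Y" "Poly_Mapping.keys m \<subseteq> V"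
  shows "monomial_eval B \<beta> b m = (\<Otimes>v\<in>V. \<beta> (fst v) (b (snd v)) [^] Poly_Mapping.lookup m v)"
  unfolding monomial_eval_def using assms value_closed
  by (intro finprod_mono_neutral_cong_left) (auto simp: in_keys_iff)

lemma monomial_eval_closed: "m \<in> monomials G Y \<Longrightarrow> monomial_eval B \<beta> b m \<in> carrier B"
  unfolding monomial_eval_def using value_closed by (intro finprod_closed) auto

lemma monomial_eval_0: "monomial_eval B \<beta> b 0 = \<one>"
  by (simp add: monomial_eval_def)

lemma monomial_eval_add:
  assumes "m \<in> monomials G Y" "m' \<in> monomials G Y"
  shows "monomial_eval B \<beta> b (m + m') = monomial_eval B \<beta> b m \<otimes> monomial_eval B \<beta> b m'"
proof -
  let ?V = "Poly_Mapping.keys m \<union> Poly_Mapping.keys m'"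
  have V: "finite ?V" "?V \<subseteq> carrier G \<times> Y" using assms by auto
  have c: "\<beta> (fst v) (b (snd v)) \<in> carrier B" if "v \<in> ?V" for v
    using value_closed V that by blast
  have "monomial_eval B \<beta> b (m + m') =
      (\<Otimes>v\<in>?V. \<beta> (fst v) (b (snd v)) [^] Poly_Mapping.lookup m v \<otimes>
                \<beta> (fst v) (b (snd v)) [^] Poly_Mapping.lookup m' v)"
    unfolding monomial_eval_superset[OF V Poly_Mapping.keys_add]
    using c by (intro finprod_cong') (auto simp: lookup_add nat_pow_mult)
  also have "\<dots> = monomial_eval B \<beta> b m \<otimes> monomial_eval B \<beta> b m'"
    using c by (subst finprod_multf) (auto simp: monomial_eval_superset[OF V])
  finally show ?thesis .
qed

lemma monomial_eval_single:
  assumes "v \<in> carrier G \<times> Y"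
  shows "monomial_eval B \<beta> b (Poly_Mapping.single v k) = \<beta> (fst v) (b (snd v)) [^] k"
proof -
  have "monomial_eval B \<beta> b (Poly_Mapping.single v k) =
      (\<Otimes>w\<in>{v}. \<beta> (fst w) (b (snd w)) [^] Poly_Mapping.lookup (Poly_Mapping.single v k) w)"
    by (rule monomial_eval_superset) (use assms in auto)
  then show ?thesis using value_closed[OF assms] by simp
qed

abbreviation "ev \<equiv> dpoly_eval B \<beta> \<iota> b"

lemma ev_alt: "ev p = (\<Oplus>m\<in>Poly_Mapping.keys p. \<iota> (Poly_Mapping.lookup p m) \<otimes> monomial_eval B \<beta> b m)"
  by (simp add: dpoly_eval_def monomial_eval_def)

lemma ev_superset:
  assumes "finite M" "M \<subseteq> monomials G Y" "Poly_Mapping.keys p \<subseteq> M"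
  shows "ev p = (\<Oplus>m\<in>M. \<iota> (Poly_Mapping.lookup p m) \<otimes> monomial_eval B \<beta> b m)"
proof -
  have "monomial_eval B \<beta> b m \<in> carrier B" if "m \<in> M" for m
    using monomial_eval_closed assms that by blast
  then show ?thesis
    unfolding ev_alt using assms
    by (intro add.finprod_mono_neutral_cong_left) (auto simp: in_keys_iff \<iota>)
qed

lemma ev_closed: "p \<in> carrier (dpoly_ring G Y) \<Longrightarrow> ev p \<in> carrier B"
  unfolding ev_alt using monomial_eval_closed
  by (intro finsum_closed) (auto simp: \<iota> dpoly_ring_simps subset_iff)

lemma ev_0: "ev 0 = \<zero>"
  by (simp add: dpoly_eval_def)

lemma ev_add:
  assumes "p \<in> carrier (dpoly_ring G Y)" "q \<in> carrier (dpoly_ring G Y)"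
  shows "ev (p + q) = ev p \<oplus> ev q"
proof -
  let ?M = "Poly_Mapping.keys p \<union> Poly_Mapping.keys q"
  have M: "finite ?M" "?M \<subseteq> monomials G Y" using assms by (auto simp: dpoly_ring_simps)
  have c: "monomial_eval B \<beta> b m \<in> carrier B" if "m \<in> ?M" for m
    using monomial_eval_closed M that by blast
  have "ev (p + q) =
      (\<Oplus>m\<in>?M. \<iota> (Poly_Mapping.lookup p m) \<otimes> monomial_eval B \<beta> b m \<oplus>
                \<iota> (Poly_Mapping.lookup q m) \<otimes> monomial_eval B \<beta> b m)"
    unfolding ev_superset[OF M Poly_Mapping.keys_add]
    using c by (intro finsum_cong') (auto simp: lookup_add \<iota> l_distr)
  also have "\<dots> = ev p \<oplus> ev q"
    using c by (subst finsum_addf) (auto simp: ev_superset[OF M] \<iota>)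
  finally show ?thesis .
qed

lemma ev_single:
  assumes "m \<in> monomials G Y"
  shows "ev (Poly_Mapping.single m c) = \<iota> c \<otimes> monomial_eval B \<beta> b m"
proof -
  have "ev (Poly_Mapping.single m c) =
      (\<Oplus>m'\<in>{m}. \<iota> (Poly_Mapping.lookup (Poly_Mapping.single m c) m') \<otimes> monomial_eval B \<beta> b m')"
    by (rule ev_superset) (use assms in auto)
  then show ?thesis using monomial_eval_closed[OF assms] by (simp add: \<iota>)
qed

lemma ev_1: "ev 1 = \<one>"
  using ev_single[of 0 1] by (simp add: monomial_eval_0 \<iota>)

lemma ev_mult:
  assumes p: "p \<in> carrier (dpoly_ring G Y)" and q: "q \<in> carrier (dpoly_ring G Y)"
  shows "ev (p * q) = ev p \<otimes> ev q"
proof -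
  have mult1: "ev (Poly_Mapping.single m c * q) = ev (Poly_Mapping.single m c) \<otimes> ev q"
    if m: "m \<in> monomials G Y" for m c
  proof -
    have "Poly_Mapping.keys q \<subseteq> monomials G Y" using q by (simp add: dpoly_ring_simps)
    then show ?thesis
    proof (induction q rule: poly_mapping_induct)
      case zero
      then show ?case using ev_closed[OF dpoly_closed_single[OF m, of c]] by (simp add: ev_0)
    next
      case (single m' c')
      have "monomial_eval B \<beta> b m \<in> carrier B" "monomial_eval B \<beta> b m' \<in> carrier B"
        using m single by (auto intro: monomial_eval_closed)
      then show ?case
        unfolding mult_single
        by (subst (1 2 3) ev_single)
          (use m single monomials_add[OF m single] in \<open>auto simp: monomial_eval_add \<iota> m_ac\<close>)
    next
      case (add p q)
      then have pq: "p \<in> carrier (dpoly_ring G Y)" "q \<in> carrier (dpoly_ring G Y)"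
        by (auto simp: dpoly_ring_simps)
      note s = dpoly_closed_single[OF m, of c]
      show ?case
        using add.IH dpoly_closed_mult[OF s pq(1)] dpoly_closed_mult[OF s pq(2)] pq ev_closed s
        by (simp add: distrib_left ev_add r_distr)
    qed
  qed
  have "Poly_Mapping.keys p \<subseteq> monomials G Y" using p by (simp add: dpoly_ring_simps)
  then show ?thesis
  proof (induction p rule: poly_mapping_induct)
    case zero
    then show ?case using ev_closed[OF q] by (simp add: ev_0)
  next
    case (single m c)
    then show ?case using mult1 by blast
  next
    case (add p p')
    then have pq: "p \<in> carrier (dpoly_ring G Y)" "p' \<in> carrier (dpoly_ring G Y)"
      by (auto simp: dpoly_ring_simps)
    show ?case
      using add.IH dpoly_closed_mult[OF pq(1) q] dpoly_closed_mult[OF pq(2) q] pq ev_closed q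
      by (simp add: distrib_right ev_add l_distr)
  qed
qed

lemma ev_ring_hom: "ev \<in> ring_hom (dpoly_ring G Y) B"
  by (rule ring_hom_memI)
    (auto simp: ev_closed ev_add ev_mult ev_1 dpoly_ring_simps(2-))

lemma ev_action:
  assumes g: "g \<in> carrier G" and p: "p \<in> carrier (dpoly_ring G Y)"
  shows "ev (dpoly_action G \<phi> Y g p) = \<beta> g (ev p)"
proof -
  note D = difference_ring_typeD[OF A g] and DB = difference_ringD[OF B]
  interpret \<beta>: ring_hom_cring B B "\<beta> g"
    using DB(3)[OF g] by unfold_locales
  have mon: "\<beta> g (monomial_eval B \<beta> b m) = monomial_eval B \<beta> b (shift_monomial G g m)"
    if "m \<in> monomials G Y" for m
  proof -
    have "Poly_Mapping.keys m \<subseteq> carrier G \<times> Y" using that by simp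
    then show ?thesis
    proof (induction m rule: poly_mapping_induct)
      case (single v k)
      then show ?case
        using g value_closed[OF single] point DB(6)[OF g, of "fst v" "b (snd v)"]
        by (auto simp: shift_monomial_single monomial_eval_single ring_hom_nat_pow[OF \<beta>.ring_hom_cring_axioms])
    next
      case (add m m')
      then show ?case
        using shift_monomial_closed[OF G.group_axioms g, of _ Y]
        by (simp add: shift_monomial_add monomial_eval_add monomial_eval_closed)
    qed (simp add: shift_monomial_0 monomial_eval_0)
  qed
  have cl: "dpoly_action G \<phi> Y g p \<in> carrier (dpoly_ring G Y)" if "p \<in> carrier (dpoly_ring G Y)" for p
    using difference_ringD(4)[OF dpoly_ring_difference_ring[OF A] g that] .
  have "Poly_Mapping.keys p \<subseteq> monomials G Y" using p by (simp add: dpoly_ring_simps)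
  then show ?thesis
  proof (induction p rule: poly_mapping_induct)
    case (single m c)
    then show ?case
      using shift_monomial_closed[OF G.group_axioms g single]
      by (simp add: dpoly_action_single D ev_single mon[symmetric] monomial_eval_closed \<iota> equiv[OF g])
  next
    case (add p q)
    then have pq: "p \<in> carrier (dpoly_ring G Y)" "q \<in> carrier (dpoly_ring G Y)"
      by (auto simp: dpoly_ring_simps)
    then show ?case
      using add.IH by (simp add: dpoly_action_add[of \<phi>, OF D(1) D(4)] ev_add cl ev_closed)
  qed (simp add: dpoly_action_0 ev_0)
qed

lemma ev_transfer:
  fixes B' :: "('c, 's) ring_scheme"
  assumes B': "difference_ring G B' \<beta>'"
    and r: "r \<in> ring_hom B B'"
    and r_equiv: "\<And>g x. g \<in> carrier G \<Longrightarrow> x \<in> carrier B \<Longrightarrow> r (\<beta> g x) = \<beta>' g (r x)"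
    and b': "\<And>y. y \<in> Y \<Longrightarrow> b' y = r (b y)"
    and p: "p \<in> carrier (dpoly_ring G Y)"
  shows "r (ev p) = dpoly_eval B' \<beta>' (\<lambda>x. r (\<iota> x)) b' p"
proof -
  interpret B': cring B' using difference_ringD[OF B'] by simp
  interpret r: ring_hom_cring B B' r using r by unfold_locales
  have mon: "r (monomial_eval B \<beta> b m) = monomial_eval B' \<beta>' b' m" if m: "m \<in> monomials G Y" for m
  proof -
    have *: "r (\<beta> (fst v) (b (snd v))) = \<beta>' (fst v) (b' (snd v)) \<and>
        \<beta> (fst v) (b (snd v)) \<in> carrier B \<and> \<beta>' (fst v) (b' (snd v)) \<in> carrier B'"
      if "v \<in> Poly_Mapping.keys m" for v
    proof -
      have v: "fst v \<in> carrier G" "snd v \<in> Y" "v \<in> carrier G \<times> Y" using m that by auto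
      have "\<beta>' (fst v) (b' (snd v)) = r (\<beta> (fst v) (b (snd v)))"
        using r_equiv v point b' by simp
      then show ?thesis
        using value_closed[OF v(3)] by simp
    qed
    have "r (monomial_eval B \<beta> b m) =
        (\<Otimes>\<^bsub>B'\<^esub>v\<in>Poly_Mapping.keys m. (r \<circ> (\<lambda>v. \<beta> (fst v) (b (snd v)) [^] Poly_Mapping.lookup m v)) v)"
      unfolding monomial_eval_def by (rule r.hom_finprod) (use * in blast)
    also have "\<dots> = monomial_eval B' \<beta>' b' m"
      unfolding monomial_eval_def
    proof (rule B'.finprod_cong')
      show "(\<lambda>v. \<beta>' (fst v) (b' (snd v)) [^]\<^bsub>B'\<^esub> Poly_Mapping.lookup m v) \<in> Poly_Mapping.keys m \<rightarrow> carrier B'"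
        using * by blast
      show "(r \<circ> (\<lambda>v. \<beta> (fst v) (b (snd v)) [^] Poly_Mapping.lookup m v)) v =
          \<beta>' (fst v) (b' (snd v)) [^]\<^bsub>B'\<^esub> Poly_Mapping.lookup m v" if "v \<in> Poly_Mapping.keys m" for v
        using ring_hom_nat_pow[OF r.ring_hom_cring_axioms] *[OF that] by (simp only: o_apply)
    qed simp
    finally show ?thesis .
  qed
  let ?u = "\<lambda>m. \<iota> (Poly_Mapping.lookup p m) \<otimes> monomial_eval B \<beta> b m"
    and ?u' = "\<lambda>m. r (\<iota> (Poly_Mapping.lookup p m)) \<otimes>\<^bsub>B'\<^esub> monomial_eval B' \<beta>' b' m"
  have u: "?u m \<in> carrier B" "r (?u m) = ?u' m" if m: "m \<in> Poly_Mapping.keys p" for m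
  proof -
    have m: "m \<in> monomials G Y" using p m by (auto simp: dpoly_ring_simps)
    show "?u m \<in> carrier B" using monomial_eval_closed[OF m] \<iota>(1) by blast
    show "r (?u m) = ?u' m"
      using r.hom_mult[OF \<iota>(1) monomial_eval_closed[OF m]] mon[OF m] by simp
  qed
  have "r (ev p) = (\<Oplus>\<^bsub>B'\<^esub>m\<in>Poly_Mapping.keys p. (r \<circ> ?u) m)"
    unfolding ev_alt by (rule r.hom_finsum) (use u(1) in blast)
  also have "\<dots> = (\<Oplus>\<^bsub>B'\<^esub>m\<in>Poly_Mapping.keys p. ?u' m)"
  proof (rule B'.finsum_cong')
    show "?u' \<in> Poly_Mapping.keys p \<rightarrow> carrier B'"
      using u r.hom_closed by (metis (no_types, lifting) Pi_I)
    show "(r \<circ> ?u) m = ?u' m" if "m \<in> Poly_Mapping.keys p" for m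
      using u(2)[OF that] by (simp only: o_apply)
  qed simp
  finally have "r (ev p) = (\<Oplus>\<^bsub>B'\<^esub>m\<in>Poly_Mapping.keys p. ?u' m)" .
  then show ?thesis by (simp add: dpoly_eval_def monomial_eval_def)
qed

end

lemma difference_closed_B2_universal:
  fixes \<phi> :: "'g \<Rightarrow> 'a::comm_ring_1 \<Rightarrow> 'a"
  assumes A: "difference_ring G ring_of_type_algebra \<phi>" and B2: "difference_closed_B2 G \<phi>"
  shows "difference_closed_B2_over TYPE('b) G \<phi>"
  unfolding difference_closed_B2_over_def
proof (intro allI impI, elim conjE)
  fix n :: nat and E :: "('g, nat, 'a) dpoly set" and B :: "'b ring" and \<beta> \<iota>
  let ?Y = "{1..n}" and ?P = "dpoly_ring G {1..n} :: ('g, nat, 'a) dpoly ring"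
  assume E: "E \<subseteq> carrier ?P" and B: "difference_ring G B \<beta>" "domain B"
    and emb: "difference_embedding G ring_of_type_algebra \<phi> B \<beta> \<iota>"
    and "common_zeros B \<beta> \<iota> ?Y E \<noteq> {}"
  then obtain b where b: "b \<in> ?Y \<rightarrow>\<^sub>E carrier B" and zero: "\<And>f. f \<in> E \<Longrightarrow> dpoly_eval B \<beta> \<iota> b f = \<zero>\<^bsub>B\<^esub>"
    by (auto simp: common_zeros_def)
  note DB = difference_ringD[OF B(1)]
  interpret B: domain B by fact
  interpret G: group G by (rule DB)
  interpret P: cring ?P by (rule dpoly_ring_cring)
  interpret ev: dpoly_evaluation G \<phi> B \<beta> \<iota> ?Y b
    using A B emb b unfolding difference_embedding_def
    by unfold_locales (auto simp: ring_of_type_algebra_simps)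
  let ?h = "dpoly_eval B \<beta> \<iota> b"
  interpret h: ring_hom_ring ?P B ?h
    by (rule ring_hom_ringI2[OF P.ring_axioms B.ring_axioms ev.ev_ring_hom])
  define C where "C = B\<lparr>carrier := ?h ` carrier ?P\<rparr>"
  have sub: "subring (?h ` carrier ?P) B"
    by (rule h.img_is_subring[OF P.carrier_is_subring])
  have C: "domain C" unfolding C_def by (rule B.subring_is_domain[OF sub])
  then interpret C: domain C .
  have CB: "carrier C \<subseteq> carrier B" unfolding C_def by (auto intro: h.hom_closed)
  have C_sel: "monoid.mult C = monoid.mult B" "one C = one B" "ring.zero C = ring.zero B" "add C = add B"
    by (simp_all add: C_def)
  have \<beta>C: "\<beta> g x \<in> carrier C" if "g \<in> carrier G" "x \<in> carrier C" for g x
    using that difference_ringD(4)[OF dpoly_ring_difference_ring[OF A] that(1)]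
      ev.ev_action[OF that(1), symmetric]
    by (auto simp: C_def)
  have \<iota>C: "\<iota> a \<in> carrier C" for a
  proof -
    have "?h (Poly_Mapping.single 0 a) = \<iota> a"
      by (simp add: ev.ev_single ev.monomial_eval_0 ev.\<iota>)
    moreover have "Poly_Mapping.single 0 a \<in> carrier ?P" by (simp add: dpoly_closed_single)
    ultimately show ?thesis unfolding C_def by force
  qed
  have bC: "b y \<in> carrier C" if "y \<in> ?Y" for y
  proof -
    let ?x = "Poly_Mapping.single (Poly_Mapping.single (\<one>\<^bsub>G\<^esub>, y) 1) 1"
    have v: "(\<one>\<^bsub>G\<^esub>, y) \<in> carrier G \<times> ?Y" using that by simp
    then have "Poly_Mapping.single (\<one>\<^bsub>G\<^esub>, y) 1 \<in> monomials G ?Y" by simp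
    then have "?h ?x = b y" "?x \<in> carrier ?P"
      using ev.point[OF that] ev.monomial_eval_single[OF v, of 1] DB(5)
      by (simp_all add: ev.ev_single dpoly_closed_single ev.\<iota>)
    then show ?thesis unfolding C_def by force
  qed

  define f where "f c = {p \<in> carrier ?P. ?h p = c}" for c
  have inj: "inj_on f (carrier C)"
    unfolding inj_on_def f_def C_def by force
  define B' where "B' = image_ring f C"
  have domB': "domain B'" unfolding B'_def by (rule C.inj_imp_image_ring_is_domain[OF inj])
  then interpret B': domain B' .
  have iso: "f \<in> ring_iso C B'" unfolding B'_def by (rule inj_imp_image_ring_iso[OF inj])
  have fhom: "f \<in> ring_hom C B'" using iso by (simp add: ring_iso_def)
  have carB': "carrier B' = f ` carrier C" unfolding B'_def by (simp add: image_ring_carrier)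
  define k where "k = inv_into (carrier C) f"
  have kf: "k (f c) = c" if "c \<in> carrier C" for c unfolding k_def using inj that by simp
  have kC: "k z \<in> carrier C" and fk: "f (k z) = z" if "z \<in> carrier B'" for z
    using that kf by (auto simp: carB')
  have khom: "k \<in> ring_hom B' C"
    using ring_iso_set_sym[OF C.ring_axioms iso] unfolding k_def ring_iso_def by simp

  define \<beta>C where "\<beta>C g = restrict (\<beta> g) (carrier C)" for g
  have dC: "difference_ring G C \<beta>C"
  proof (rule difference_ringI[OF G.group_axioms C.is_cring])
    fix g assume g: "g \<in> carrier G"
    show "\<beta>C g \<in> ring_hom C C"
      unfolding \<beta>C_def using g \<beta>C CB DB(3)[OF g] C.a_closed C.m_closed C.one_closed
      by (intro ring_hom_memI)
        (auto simp: C_sel ring_hom_one subset_iff intro!: ring_hom_mult ring_hom_add)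
  qed (use CB in \<open>auto simp: \<beta>C_def \<beta>C DB(5,6) subset_iff\<close>)
  define \<beta>' where "\<beta>' g = (\<lambda>z\<in>carrier B'. f (\<beta>C g (k z)))" for g
  note DC = difference_ringD[OF dC]
  have dB': "difference_ring G B' \<beta>'"
  proof (rule difference_ringI[OF G.group_axioms B'.is_cring])
    fix g assume g: "g \<in> carrier G"
    have "f \<circ> \<beta>C g \<circ> k \<in> ring_hom B' B'"
      using khom DC(3)[OF g] fhom by (auto intro!: ring_hom_trans)
    then show "\<beta>' g \<in> ring_hom B' B'"
      unfolding \<beta>'_def ring_hom_def by auto
  qed (use fk kf kC DC(4,5,6) carB' in \<open>auto simp: \<beta>'_def\<close>)
  interpret evC: dpoly_evaluation G \<phi> C \<beta>C \<iota> ?Y b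
    using A dC ev.equiv \<iota>C bC ev.hom
    by unfold_locales (auto simp: \<beta>C_def C_sel ring_hom_def ring_of_type_algebra_simps)
  have hC: "dpoly_eval C \<beta>C \<iota> b p = ?h p" if "p \<in> carrier ?P" for p
    using evC.ev_transfer[OF B(1), of "\<lambda>x. x" b p] that CB
    by (simp add: \<beta>C_def ring_hom_def C_sel subset_iff)
  define b' where "b' = (\<lambda>y\<in>?Y. f (b y))"
  have hB': "dpoly_eval B' \<beta>' (\<lambda>x. f (\<iota> x)) b' p = f (?h p)" if "p \<in> carrier ?P" for p
    using evC.ev_transfer[OF dB' fhom, of b' p] that hC[OF that] kf carB'
    by (simp add: \<beta>'_def b'_def)
  have "difference_embedding G ring_of_type_algebra \<phi> B' \<beta>' (\<lambda>x. f (\<iota> x))"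
    unfolding difference_embedding_def
  proof (intro conjI ballI)
    show "(\<lambda>x. f (\<iota> x)) \<in> ring_hom ring_of_type_algebra B'"
      using ring_hom_trans[OF evC.hom fhom] by (simp add: comp_def)
    show "inj_on (\<lambda>x. f (\<iota> x)) (carrier ring_of_type_algebra)"
      using emb inj \<iota>C unfolding difference_embedding_def inj_on_def by blast
    show "f (\<iota> (\<phi> g a)) = \<beta>' g (f (\<iota> a))" if "g \<in> carrier G" for g a
      using that \<iota>C[of a] kf carB' ev.equiv[OF that] by (simp add: \<beta>'_def \<beta>C_def)
  qed
  moreover have "b' \<in> common_zeros B' \<beta>' (\<lambda>x. f (\<iota> x)) ?Y E"
  proof -
    have "f \<zero>\<^bsub>B\<^esub> = \<zero>\<^bsub>B'\<^esub>"
      using ring_hom_zero[OF fhom C.ring_axioms B'.ring_axioms] by (simp add: C_sel)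
    then show ?thesis
      using zero hB' E bC carB' unfolding common_zeros_def b'_def by auto
  qed
  ultimately show "zero_set \<phi> ?Y E \<noteq> {}"
    using B2 E dB' domB' unfolding difference_closed_B2_def difference_closed_B2_over_def by blast
qed

end

theory Submission
  imports Defs
begin

text \<open>Rabinowitsch trick. Suppose \<open>f \<notin> \<tt>\<close>. The ideal quotient \<open>N = (\<tt> : f)\<close> is again a proper perfect
  difference ideal, and \<open>f\<close> is a non-zero-divisor modulo \<open>N\<close>. Hence \<open>f\<close> is invertible in the total
  ring of fractions of \<open>K{y\<^sub>1,\<dots>,y\<^sub>n}/N\<close>, which is a difference ring whose zero ideal is perfect.
  Sending a further variable \<open>y\<^sub>n\<^sub>+\<^sub>1\<close> to \<open>1/f\<close>, the kernel of the evaluation is a proper perfect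
  difference ideal of \<open>K{y\<^sub>1,\<dots>,y\<^sub>n\<^sub>+\<^sub>1}\<close> containing \<open>\<tt>\<close> and \<open>y\<^sub>n\<^sub>+\<^sub>1 f - 1\<close>; a zero of it in \<open>K\<close>, which
  exists by (B1), gives a zero of \<open>\<tt>\<close> at which \<open>f\<close> does not vanish.\<close>

section \<open>Perfect difference ideals\<close>

lemma perfect_difference_idealD:
  fixes r :: nat and k :: "nat \<Rightarrow> nat"
  assumes "perfect_difference_ideal G R \<phi> I" "a \<in> carrier R" "1 \<le> r"
    and "\<And>i. i \<in> {1..r} \<Longrightarrow> \<tau> i \<in> carrier G \<and> 0 < k i"
    and "(\<Otimes>\<^bsub>R\<^esub>i\<in>{1..r}. \<phi> (\<tau> i) a [^]\<^bsub>R\<^esub> k i) \<in> I"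
  shows "a \<in> I"
  using assms unfolding perfect_difference_ideal_def by blast

lemma perfect_difference_idealI:
  assumes "ideal I R" "\<And>g a. g \<in> carrier G \<Longrightarrow> a \<in> I \<Longrightarrow> \<phi> g a \<in> I"
    and "\<And>a r \<tau> k. \<lbrakk>a \<in> carrier R; 1 \<le> r; \<And>i. i \<in> {1..r::nat} \<Longrightarrow> \<tau> i \<in> carrier G \<and> 0 < (k i :: nat);
      (\<Otimes>\<^bsub>R\<^esub>i\<in>{1..r}. \<phi> (\<tau> i) a [^]\<^bsub>R\<^esub> k i) \<in> I\<rbrakk> \<Longrightarrow> a \<in> I"
  shows "perfect_difference_ideal G R \<phi> I"
  using assms unfolding perfect_difference_ideal_def difference_ideal_def by blast

text \<open>An equivariant homomorphism carries a product of powers of translates of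
  \<open>a\<close> to the same product formed from \<open>h a\<close>, so the condition on
  \<open>J\<close> pulls back. With \<open>J\<close> the zero ideal it shows that kernels of
  evaluations are perfect.\<close>

lemma perfect_difference_ideal_preimage:
  assumes R: "difference_ring G R \<phi>" and S: "difference_ring G S \<psi>"
    and h: "h \<in> ring_hom R S"
    and equiv: "\<And>g a. g \<in> carrier G \<Longrightarrow> a \<in> carrier R \<Longrightarrow> h (\<phi> g a) = \<psi> g (h a)"
    and J: "perfect_difference_ideal G S \<psi> J"
  shows "perfect_difference_ideal G R \<phi> {a \<in> carrier R. h a \<in> J}"
proof -
  note DR = difference_ringD[OF R] and DS = difference_ringD[OF S]
  interpret R: cring R by (rule DR)
  interpret S: cring S by (rule DS)
  interpret h: ring_hom_cring R S h using h by unfold_locales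
  have J_act: "\<psi> g x \<in> J" if "g \<in> carrier G" "x \<in> J" for g x
    using J that by (auto simp: perfect_difference_ideal_def difference_ideal_def)
  show ?thesis
  proof (rule perfect_difference_idealI)
    have "ring_hom_ring R S h"
      by (rule ring_hom_ringI2[OF R.ring_axioms S.ring_axioms h])
    then show "ideal {a \<in> carrier R. h a \<in> J} R"
      using J by (intro ring_hom_ring.ideal_vimage) (auto simp: perfect_difference_ideal_def difference_ideal_def)
    show "\<phi> g a \<in> {a \<in> carrier R. h a \<in> J}" if "g \<in> carrier G" "a \<in> {a \<in> carrier R. h a \<in> J}" for g a
      using that J_act DR(4) equiv by simp
    fix a r \<tau> and k :: "nat \<Rightarrow> nat"
    assume a: "a \<in> carrier R" and r: "1 \<le> r" and \<tau>: "\<And>i. i \<in> {1..r} \<Longrightarrow> \<tau> i \<in> carrier G \<and> 0 < k i"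
      and prod: "(\<Otimes>\<^bsub>R\<^esub>i\<in>{1..r}. \<phi> (\<tau> i) a [^]\<^bsub>R\<^esub> k i) \<in> {a \<in> carrier R. h a \<in> J}"
    have cl: "\<phi> (\<tau> i) a \<in> carrier R" if "i \<in> {1..r}" for i
      using \<tau>[OF that] a DR(4) by blast
    have "h (\<Otimes>\<^bsub>R\<^esub>i\<in>{1..r}. \<phi> (\<tau> i) a [^]\<^bsub>R\<^esub> k i) =
        (\<Otimes>\<^bsub>S\<^esub>i\<in>{1..r}. (h \<circ> (\<lambda>i. \<phi> (\<tau> i) a [^]\<^bsub>R\<^esub> k i)) i)"
      using cl by (intro h.hom_finprod) auto
    also have "\<dots> = (\<Otimes>\<^bsub>S\<^esub>i\<in>{1..r}. \<psi> (\<tau> i) (h a) [^]\<^bsub>S\<^esub> k i)"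
    proof (rule S.finprod_cong')
      show "(h \<circ> (\<lambda>i. \<phi> (\<tau> i) a [^]\<^bsub>R\<^esub> k i)) i = \<psi> (\<tau> i) (h a) [^]\<^bsub>S\<^esub> k i" if "i \<in> {1..r}" for i
        using ring_hom_nat_pow[OF h.ring_hom_cring_axioms cl[OF that]] equiv[OF _ a] \<tau>[OF that] by simp
    qed (use \<tau> a DS(4) in auto)
    finally have "(\<Otimes>\<^bsub>S\<^esub>i\<in>{1..r}. \<psi> (\<tau> i) (h a) [^]\<^bsub>S\<^esub> k i) \<in> J" using prod by simp
    then have "h a \<in> J"
      by (rule perfect_difference_idealD[OF J h.hom_closed[OF a] r, rotated]) (rule \<tau>)
    then show "a \<in> {a \<in> carrier R. h a \<in> J}" using a by simp
  qed
qed

text \<open>Perfectness of \<open>I\<close> is applied to elements that already contain the factor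
  \<open>f\<close>: each time, a suitable product of their translates is a multiple of an element
  known to lie in \<open>I\<close>. The remaining factors are absorbed because \<open>I\<close> is
  an ideal.\<close>

lemma perfect_difference_ideal_colon:
  fixes R (structure)
  assumes R: "difference_ring G R \<phi>" and I: "perfect_difference_ideal G R \<phi> I"
    and f: "f \<in> carrier R"
  shows "perfect_difference_ideal G R \<phi> {a \<in> carrier R. f \<otimes> a \<in> I}" (is "perfect_difference_ideal G R \<phi> ?N")
proof -
  note D = difference_ringD[OF R]
  interpret G: group G by (rule D)
  interpret cring R by (rule D)
  interpret I: ideal I R
    using I by (simp add: perfect_difference_ideal_def difference_ideal_def)
  have inv_I: "\<phi> g a \<in> I" if "g \<in> carrier G" "a \<in> I" for g a
    using I that by (auto simp: perfect_difference_ideal_def difference_ideal_def)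
  have ideal: "ideal ?N R"
  proof (rule idealI[OF ring_axioms])
    show "subgroup ?N (add_monoid R)"
      using f by unfold_locales
        (auto simp: r_distr r_minus I.a_closed a_inv_def[symmetric] intro: I.a_inv_closed)
  next
    fix a x assume a: "a \<in> ?N" and x: "x \<in> carrier R"
    then have "f \<otimes> (x \<otimes> a) = x \<otimes> (f \<otimes> a)" using f by (simp add: m_lcomm)
    then show "x \<otimes> a \<in> ?N" using a x by (simp add: I.I_l_closed)
    then show "a \<otimes> x \<in> ?N" using a x by (simp add: m_comm)
  qed
  have action: "f \<otimes> \<phi> g a \<in> I" if g: "g \<in> carrier G" and a: "a \<in> carrier R" "f \<otimes> a \<in> I" for g a
  proof -
    \<comment> \<open>With \<open>c = f g(a)\<close>, the product of \<open>c\<close> and \<open>g\<^sup>-\<^sup>1(c) = g\<^sup>-\<^sup>1(f) a\<close> is a multiple of \<open>f a\<close>.\<close>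
    let ?h = "inv\<^bsub>G\<^esub> g" and ?c = "f \<otimes> \<phi> g a"
    let ?\<tau> = "\<lambda>i::nat. if i = 1 then \<one>\<^bsub>G\<^esub> else ?h"
    have h: "?h \<in> carrier G" using g by simp
    have c: "?c \<in> carrier R" using f g a D(4) by simp
    have hc: "\<phi> ?h ?c = \<phi> ?h f \<otimes> a"
      using ring_hom_mult[OF D(3)[OF h] f D(4)[OF g a(1)]] D(6)[OF h g a(1), symmetric] D(5)[OF a(1)] g by simp
    have "{1..2::nat} = {1,2}" by auto
    then have "(\<Otimes>i\<in>{1..2}. \<phi> (?\<tau> i) ?c [^] (1::nat)) = ?c \<otimes> (\<phi> ?h f \<otimes> a)"
      using c hc h D(4)[OF h] a f by (simp add: D(5) Pi_def)
    also have "\<dots> = (\<phi> ?h f \<otimes> \<phi> g a) \<otimes> (f \<otimes> a)"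
      using f a D(4)[OF h f] D(4)[OF g a(1)] by (simp add: m_ac)
    also have "\<dots> \<in> I"
      using f a D(4)[OF h f] D(4)[OF g a(1)] by (simp add: I.I_l_closed)
    finally show ?thesis by (rule perfect_difference_idealD[OF I c, rotated 2]) (use h in auto)
  qed
  have root: "f \<otimes> a \<in> I" if a: "a \<in> carrier R" and r: "1 \<le> r" and \<tau>: "\<And>i. i \<in> {1..r} \<Longrightarrow> \<tau> i \<in> carrier G \<and> 0 < k i"
    and prod: "f \<otimes> (\<Otimes>i\<in>{1..r}. \<phi> (\<tau> i) a [^] k i) \<in> I" 
    for a and r :: nat and \<tau> and k :: "nat \<Rightarrow> nat"
  proof -
    \<comment> \<open>The element \<open>f a\<close> itself is appended as factor number r+1, with
      exponent 1. It supplies the one untranslated \<open>f\<close> that must multiply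
      \<open>?Pa\<close>; the translates of \<open>f\<close> collected in \<open>?Pf\<close> are
      only a cofactor.\<close>
    let ?\<tau> = "\<tau>(Suc r := \<one>\<^bsub>G\<^esub>)" and ?k = "k(Suc r := 1)" and ?fa = "f \<otimes> a"
    have cl: "\<phi> (\<tau> i) x \<in> carrier R" if "i \<in> {1..r}" "x \<in> carrier R" for i x using D(4) \<tau> that by blast
    have fa: "?fa \<in> carrier R" using f a by simp
    let ?Pf = "\<Otimes>i\<in>{1..r}. \<phi> (\<tau> i) f [^] k i" and ?Pa = "\<Otimes>i\<in>{1..r}. \<phi> (\<tau> i) a [^] k i"
    have P: "?Pf \<in> carrier R" "?Pa \<in> carrier R" using cl f a by auto
    have "(\<Otimes>i\<in>{1..Suc r}. \<phi> (?\<tau> i) ?fa [^] ?k i) = ?fa \<otimes> (\<Otimes>i\<in>{1..r}. \<phi> (?\<tau> i) ?fa [^] ?k i)"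
      using cl fa by (simp add: atLeastAtMostSuc_conv D(5) Pi_def)
    also have "(\<Otimes>i\<in>{1..r}. \<phi> (?\<tau> i) ?fa [^] ?k i) = (\<Otimes>i\<in>{1..r}. \<phi> (\<tau> i) f [^] k i \<otimes> \<phi> (\<tau> i) a [^] k i)"
      using cl f a \<tau> by (intro finprod_cong') (auto simp: ring_hom_mult[OF D(3)] nat_pow_distrib)
    also have "\<dots> = ?Pf \<otimes> ?Pa" using cl f a by (intro finprod_multf) auto
    also have "?fa \<otimes> (?Pf \<otimes> ?Pa) = (a \<otimes> ?Pf) \<otimes> (f \<otimes> ?Pa)"
      using P f a by (simp add: m_ac)
    also have "\<dots> \<in> I" using prod P a by (simp add: I.I_l_closed)
    finally show ?thesis
      by (rule perfect_difference_idealD[OF I fa, rotated 2]) (use \<tau> in \<open>auto\<close>)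
  qed
  show ?thesis
  proof (rule perfect_difference_idealI[OF ideal])
    show "\<phi> g a \<in> ?N" if "g \<in> carrier G" "a \<in> ?N" for g a
      using that action D(4) by simp
    show "a \<in> ?N" if "a \<in> carrier R" "1 \<le> r" "\<And>i. i \<in> {1..r::nat} \<Longrightarrow> \<tau> i \<in> carrier G \<and> 0 < k i"
      "(\<Otimes>i\<in>{1..r}. \<phi> (\<tau> i) a [^] k i) \<in> ?N" for a r \<tau> and k :: "nat \<Rightarrow> nat"
      using root[OF that(1-3)] that(1,4) by simp
  qed
qed

text \<open>The square of \<open>f a\<close> is a multiple of \<open>f (f a)\<close>, and a perfect
  ideal is radical (take the single translate by the identity, with exponent 2). Consequently
  \<open>f\<close> is a non-zero-divisor modulo the ideal quotient of \<open>I\<close> by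
  \<open>f\<close>.\<close>

lemma perfect_difference_ideal_colon_cancel:
  fixes R (structure)
  assumes R: "difference_ring G R \<phi>" and I: "perfect_difference_ideal G R \<phi> I"
    and f: "f \<in> carrier R" and a: "a \<in> carrier R" and "f \<otimes> (f \<otimes> a) \<in> I"
  shows "f \<otimes> a \<in> I"
proof -
  note D = difference_ringD[OF R]
  interpret G: group G by (rule D)
  interpret cring R by (rule D)
  interpret I: ideal I R
    using I by (simp add: perfect_difference_ideal_def difference_ideal_def)
  have "(\<Otimes>i\<in>{1..1::nat}. \<phi> \<one>\<^bsub>G\<^esub> (f \<otimes> a) [^] (2::nat)) = a \<otimes> (f \<otimes> (f \<otimes> a))"
    using f a by (simp add: D(5) numeral_2_eq_2 m_ac)
  also have "\<dots> \<in> I" using assms by (simp add: I.I_l_closed)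
  finally show ?thesis
    by (rule perfect_difference_idealD[OF I, rotated 3]) (use f a in auto)
qed

section \<open>The total ring of fractions modulo a perfect difference ideal\<close>

text \<open>The quotient of \<open>R\<close> by \<open>N\<close> is never formed: representatives in
  \<open>R\<close> are used throughout, with congruence modulo \<open>N\<close> in place of
  equality.\<close>

locale perfect_quotient =
  fixes G :: "('g, 'm) monoid_scheme" and R :: "('b, 'r) ring_scheme" (structure) and \<phi> N
  assumes R: "difference_ring G R \<phi>" and perfect: "perfect_difference_ideal G R \<phi> N"
begin

sublocale cring R using difference_ringD[OF R] by simp
sublocale G: group G using difference_ringD[OF R] by simp
sublocale N: ideal N R
  using perfect by (simp add: perfect_difference_ideal_def difference_ideal_def)

lemmas act = difference_ringD(3-6)[OF R]

lemma act_N: "g \<in> carrier G \<Longrightarrow> a \<in> N \<Longrightarrow> \<phi> g a \<in> N"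
  using perfect by (auto simp: perfect_difference_ideal_def difference_ideal_def)

text \<open>These are the representatives of the non-zero-divisors of R/N. Admitting all of them as
  denominators, and not just powers of one element, makes the set of denominators stable under the
  group.\<close>

definition regular :: "'b set" where
  "regular = {s \<in> carrier R. \<forall>a\<in>carrier R. s \<otimes> a \<in> N \<longrightarrow> a \<in> N}"

lemma regularI:
  "s \<in> carrier R \<Longrightarrow> (\<And>a. a \<in> carrier R \<Longrightarrow> s \<otimes> a \<in> N \<Longrightarrow> a \<in> N) \<Longrightarrow> s \<in> regular"
  unfolding regular_def by blast

lemma regular_carrier [simp]: "s \<in> regular \<Longrightarrow> s \<in> carrier R"
  unfolding regular_def by blast

lemma regular_cancel: "s \<in> regular \<Longrightarrow> a \<in> carrier R \<Longrightarrow> s \<otimes> a \<in> N \<Longrightarrow> a \<in> N"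
  unfolding regular_def by blast

lemma regular_one [simp]: "\<one> \<in> regular"
  by (rule regularI) simp_all

lemma regular_mult [simp]:
  assumes "s \<in> regular" "u \<in> regular"
  shows "s \<otimes> u \<in> regular"
proof (rule regularI)
  fix a assume "a \<in> carrier R" "s \<otimes> u \<otimes> a \<in> N"
  then show "a \<in> N"
    using assms regular_cancel[of s "u \<otimes> a"] regular_cancel[of u a] by (simp add: m_assoc)
qed (use assms in simp)

text \<open>Applying the inverse of \<open>g\<close> turns a relation \<open>g(s) a\<close> in
  \<open>N\<close> into one for \<open>s\<close>, where \<open>s\<close> can be cancelled; applying
  \<open>g\<close> leads back, since \<open>N\<close> is stable under both. This lets the group act
  on fractions.\<close>

lemma regular_act:
  assumes g: "g \<in> carrier G" and s: "s \<in> regular"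
  shows "\<phi> g s \<in> regular"
proof -
  let ?h = "inv\<^bsub>G\<^esub> g"
  have h: "?h \<in> carrier G" using g by simp
  have inv: "\<phi> ?h (\<phi> g x) = x" "\<phi> g (\<phi> ?h x) = x" if "x \<in> carrier R" for x
    using act(4)[OF h g that] act(4)[OF g h that] g act(3)[OF that] by simp_all
  show ?thesis
  proof (rule regularI)
    show "\<phi> g s \<in> carrier R" using act(2)[OF g] s by simp
    fix a assume a: "a \<in> carrier R" and N: "\<phi> g s \<otimes> a \<in> N"
    have "\<phi> ?h (\<phi> g s \<otimes> a) = s \<otimes> \<phi> ?h a"
      using ring_hom_mult[OF act(1)[OF h]] act(2)[OF g] a s inv by simp
    then have "\<phi> ?h a \<in> N"
      using act_N[OF h N] regular_cancel[OF s act(2)[OF h a]] by simp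
    then show "a \<in> N" using act_N[OF g] inv(2)[OF a] by fastforce
  qed
qed

text \<open>The fraction \<open>a/s\<close> as an equivalence class; equality needs no auxiliary factor, because all
  denominators are non-zero-divisors modulo \<open>N\<close>.\<close>

definition frac :: "'b \<Rightarrow> 'b \<Rightarrow> ('b \<times> 'b) set" where
  "frac a s = {(b, u). b \<in> carrier R \<and> u \<in> regular \<and> a \<otimes> u \<ominus> b \<otimes> s \<in> N}"

section \<open>Equality of fractions as congruence modulo \<open>N\<close>\<close>

lemma minus_swap:
  assumes "a \<in> carrier R" "b \<in> carrier R" "a \<ominus> b \<in> N"
  shows "b \<ominus> a \<in> N"
proof -
  have "b \<ominus> a = \<ominus> (a \<ominus> b)" using assms by (simp add: minus_eq minus_add a_comm)
  then show ?thesis using N.a_inv_closed[OF assms(3)] by simp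
qed

text \<open>After multiplication by the middle denominator \<open>u\<close>, the conclusion is a
  linear combination of the two hypotheses; \<open>u\<close> can then be cancelled because it is
  regular.\<close>

lemma frac_trans:
  assumes "a \<in> carrier R" "b \<in> carrier R" "c \<in> carrier R" "s \<in> regular" "u \<in> regular" "v \<in> regular"
    and 1: "a \<otimes> u \<ominus> b \<otimes> s \<in> N" and 2: "b \<otimes> v \<ominus> c \<otimes> u \<in> N"
  shows "a \<otimes> v \<ominus> c \<otimes> s \<in> N"
proof -
  have cl: "s \<in> carrier R" "u \<in> carrier R" "v \<in> carrier R" using assms by auto
  have "u \<otimes> (a \<otimes> v \<ominus> c \<otimes> s) = v \<otimes> (a \<otimes> u \<ominus> b \<otimes> s) \<oplus> s \<otimes> (b \<otimes> v \<ominus> c \<otimes> u)"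
    using assms(1-3) cl by algebra
  also have "\<dots> \<in> N" using 1 2 cl by (simp add: N.I_l_closed N.a_closed)
  finally show ?thesis by (rule regular_cancel[OF assms(5), rotated]) (use assms(1-3) cl in simp)
qed

lemma frac_self: "a \<in> carrier R \<Longrightarrow> s \<in> regular \<Longrightarrow> (a, s) \<in> frac a s"
  by (simp add: frac_def minus_eq r_neg)

lemma frac_eq_iff:
  assumes "a \<in> carrier R" "b \<in> carrier R" "s \<in> regular" "u \<in> regular"
  shows "frac a s = frac b u \<longleftrightarrow> a \<otimes> u \<ominus> b \<otimes> s \<in> N"
proof
  have "(b, u) \<in> frac b u" using assms by (simp add: frac_self)
  then show "a \<otimes> u \<ominus> b \<otimes> s \<in> N" if "frac a s = frac b u"
    using that by (auto simp: frac_def)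
  show "frac a s = frac b u" if *: "a \<otimes> u \<ominus> b \<otimes> s \<in> N"
  proof -
    have "b \<otimes> s \<ominus> a \<otimes> u \<in> N" using * assms by (simp add: minus_swap)
    then show ?thesis
      using * assms frac_trans unfolding frac_def by blast
  qed
qed

lemma frac_eqI:
  assumes "a \<in> carrier R" "b \<in> carrier R" "s \<in> regular" "u \<in> regular" "a \<otimes> u = b \<otimes> s"
  shows "frac a s = frac b u"
  using assms by (simp add: frac_eq_iff minus_eq r_neg)

lemma frac_memD:
  assumes "(b, u) \<in> frac a s"
  shows "b \<in> carrier R" "u \<in> regular" "a \<otimes> u \<ominus> b \<otimes> s \<in> N"
  using assms by (auto simp: frac_def)

text \<open>Sum and product are unions over all pairs of representatives, which avoids choosing any.
  Each union collapses to a single class once independence of the representatives is known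
  (\<open>frac_mult\<close>, \<open>frac_add\<close>).\<close>

definition fractions :: "('b \<times> 'b) set ring" where
  "fractions =
     \<lparr>carrier = {frac a s | a s. a \<in> carrier R \<and> s \<in> regular},
      monoid.mult = (\<lambda>P Q. \<Union>(a, s)\<in>P. \<Union>(b, u)\<in>Q. frac (a \<otimes> b) (s \<otimes> u)),
      one = frac \<one> \<one>, ring.zero = frac \<zero> \<one>,
      add = (\<lambda>P Q. \<Union>(a, s)\<in>P. \<Union>(b, u)\<in>Q. frac (a \<otimes> u \<oplus> b \<otimes> s) (s \<otimes> u))\<rparr>"

lemma frac_closed [simp]: "a \<in> carrier R \<Longrightarrow> s \<in> regular \<Longrightarrow> frac a s \<in> carrier fractions"
  by (auto simp: fractions_def)

lemma fractions_cases:
  assumes "P \<in> carrier fractions"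
  obtains a s where "a \<in> carrier R" "s \<in> regular" "P = frac a s"
  using assms by (auto simp: fractions_def)

lemma fractions_one: "\<one>\<^bsub>fractions\<^esub> = frac \<one> \<one>"
  and fractions_zero: "\<zero>\<^bsub>fractions\<^esub> = frac \<zero> \<one>"
  by (simp_all add: fractions_def)

text \<open>A union of a constant family over a nonempty index set is its constant value, and every
  class contains the pair that defines it.\<close>

lemma frac_lift:
  assumes "a \<in> carrier R" "s \<in> regular" "b \<in> carrier R" "u \<in> regular"
    and "\<And>a' s' b' u'. (a', s') \<in> frac a s \<Longrightarrow> (b', u') \<in> frac b u \<Longrightarrow> h a' s' b' u' = h a s b u"
  shows "(\<Union>(a', s')\<in>frac a s. \<Union>(b', u')\<in>frac b u. h a' s' b' u') = h a s b u"
proof -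
  have "frac a s \<noteq> {}" "frac b u \<noteq> {}"
    using frac_self assms(1-4) by blast+
  then show ?thesis by (auto intro!: SUP_eq_const simp: assms(5))
qed

lemma frac_mult:
  assumes as: "a \<in> carrier R" "s \<in> regular" "b \<in> carrier R" "u \<in> regular"
  shows "frac a s \<otimes>\<^bsub>fractions\<^esub> frac b u = frac (a \<otimes> b) (s \<otimes> u)"
proof -
  have "(\<Union>(a', s')\<in>frac a s. \<Union>(b', u')\<in>frac b u. frac (a' \<otimes> b') (s' \<otimes> u')) = frac (a \<otimes> b) (s \<otimes> u)"
  proof (rule frac_lift[OF as])
    fix a' s' b' u' assume "(a', s') \<in> frac a s" "(b', u') \<in> frac b u"
    note 1 = frac_memD[OF this(1)] and 2 = frac_memD[OF this(2)]
    have cl: "s \<in> carrier R" "u \<in> carrier R" "s' \<in> carrier R" "u' \<in> carrier R" using as 1 2 by auto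
    \<comment> \<open>The representatives are exchanged one fraction at a time: the mixed term
      \<open>a' b s u'\<close> cancels, and what remains is a combination of the two given elements
      of \<open>N\<close>.\<close>
    have "(a \<otimes> b) \<otimes> (s' \<otimes> u') \<ominus> (a' \<otimes> b') \<otimes> (s \<otimes> u) =
        (b \<otimes> u') \<otimes> (a \<otimes> s' \<ominus> a' \<otimes> s) \<oplus> (a' \<otimes> s) \<otimes> (b \<otimes> u' \<ominus> b' \<otimes> u)"
      using as(1,3) 1(1) 2(1) cl by algebra
    also have "\<dots> \<in> N" using as 1 2 cl by (intro N.a_closed N.I_l_closed) auto
    finally show "frac (a' \<otimes> b') (s' \<otimes> u') = frac (a \<otimes> b) (s \<otimes> u)"
      using as 1 2 by (subst eq_commute) (simp add: frac_eq_iff)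
  qed
  then show ?thesis by (simp add: fractions_def)
qed

lemma frac_add:
  assumes as: "a \<in> carrier R" "s \<in> regular" "b \<in> carrier R" "u \<in> regular"
  shows "frac a s \<oplus>\<^bsub>fractions\<^esub> frac b u = frac (a \<otimes> u \<oplus> b \<otimes> s) (s \<otimes> u)"
proof -
  have "(\<Union>(a', s')\<in>frac a s. \<Union>(b', u')\<in>frac b u. frac (a' \<otimes> u' \<oplus> b' \<otimes> s') (s' \<otimes> u')) =
      frac (a \<otimes> u \<oplus> b \<otimes> s) (s \<otimes> u)"
  proof (rule frac_lift[OF as])
    fix a' s' b' u' assume "(a', s') \<in> frac a s" "(b', u') \<in> frac b u"
    note 1 = frac_memD[OF this(1)] and 2 = frac_memD[OF this(2)]
    have cl: "s \<in> carrier R" "u \<in> carrier R" "s' \<in> carrier R" "u' \<in> carrier R" using as 1 2 by auto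
    have "(a \<otimes> u \<oplus> b \<otimes> s) \<otimes> (s' \<otimes> u') \<ominus> (a' \<otimes> u' \<oplus> b' \<otimes> s') \<otimes> (s \<otimes> u) =
        (u \<otimes> u') \<otimes> (a \<otimes> s' \<ominus> a' \<otimes> s) \<oplus> (s \<otimes> s') \<otimes> (b \<otimes> u' \<ominus> b' \<otimes> u)"
      using as(1,3) 1(1) 2(1) cl by algebra
    also have "\<dots> \<in> N" using as 1 2 cl by (intro N.a_closed N.I_l_closed) auto
    finally show "frac (a' \<otimes> u' \<oplus> b' \<otimes> s') (s' \<otimes> u') = frac (a \<otimes> u \<oplus> b \<otimes> s) (s \<otimes> u)"
      using as 1 2 by (subst eq_commute) (simp add: frac_eq_iff)
  qed
  then show ?thesis by (simp add: fractions_def)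
qed

lemma fractions_cring: "cring fractions"
proof (rule cringI)
  show "abelian_group fractions"
  proof (rule abelian_groupI)
    fix P Q T assume P: "P \<in> carrier fractions" and Q: "Q \<in> carrier fractions" and T: "T \<in> carrier fractions"
    from P obtain a s where P: "a \<in> carrier R" "s \<in> regular" "P = frac a s" by (rule fractions_cases)
    from Q obtain b u where Q: "b \<in> carrier R" "u \<in> regular" "Q = frac b u" by (rule fractions_cases)
    from T obtain c v where T: "c \<in> carrier R" "v \<in> regular" "T = frac c v" by (rule fractions_cases)
    have cl: "s \<in> carrier R" "u \<in> carrier R" "v \<in> carrier R" using P Q T by auto
    note eqs = P(3) Q(3) T(3) and as = P(1,2) Q(1,2) T(1,2)
    show "P \<oplus>\<^bsub>fractions\<^esub> Q \<in> carrier fractions" using as cl by (simp add: eqs frac_add)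
    have "((a \<otimes> u \<oplus> b \<otimes> s) \<otimes> v \<oplus> c \<otimes> (s \<otimes> u)) = (a \<otimes> (u \<otimes> v) \<oplus> (b \<otimes> v \<oplus> c \<otimes> u) \<otimes> s)"
      using P(1) Q(1) T(1) cl by algebra
    then show "P \<oplus>\<^bsub>fractions\<^esub> Q \<oplus>\<^bsub>fractions\<^esub> T = P \<oplus>\<^bsub>fractions\<^esub> (Q \<oplus>\<^bsub>fractions\<^esub> T)"
      using as cl by (simp add: eqs frac_add m_assoc)
    show "P \<oplus>\<^bsub>fractions\<^esub> Q = Q \<oplus>\<^bsub>fractions\<^esub> P"
      using as cl by (simp add: eqs frac_add m_comm a_comm)
    show "\<zero>\<^bsub>fractions\<^esub> \<oplus>\<^bsub>fractions\<^esub> P = P"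
      using as cl by (simp add: eqs fractions_zero frac_add)
    have "\<ominus> a \<otimes> s \<oplus> a \<otimes> s = \<zero>" using P(1) cl by algebra
    then have "frac (\<ominus> a) s \<oplus>\<^bsub>fractions\<^esub> P = \<zero>\<^bsub>fractions\<^esub>"
      using as cl by (simp add: eqs fractions_zero frac_add) (rule frac_eqI; simp)
    then show "\<exists>Q\<in>carrier fractions. Q \<oplus>\<^bsub>fractions\<^esub> P = \<zero>\<^bsub>fractions\<^esub>"
      using as by (intro bexI[of _ "frac (\<ominus> a) s"]) simp_all
  qed (simp add: fractions_zero)
  show "comm_monoid fractions"
  proof (rule comm_monoidI)
    fix P Q T assume P: "P \<in> carrier fractions" and Q: "Q \<in> carrier fractions" and T: "T \<in> carrier fractions"
    from P obtain a s where P: "a \<in> carrier R" "s \<in> regular" "P = frac a s" by (rule fractions_cases)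
    from Q obtain b u where Q: "b \<in> carrier R" "u \<in> regular" "Q = frac b u" by (rule fractions_cases)
    from T obtain c v where T: "c \<in> carrier R" "v \<in> regular" "T = frac c v" by (rule fractions_cases)
    have cl: "s \<in> carrier R" "u \<in> carrier R" "v \<in> carrier R" using P Q T by auto
    note eqs = P(3) Q(3) T(3) and as = P(1,2) Q(1,2) T(1,2)
    show "P \<otimes>\<^bsub>fractions\<^esub> Q \<in> carrier fractions" using as cl by (simp add: eqs frac_mult)
    show "P \<otimes>\<^bsub>fractions\<^esub> Q \<otimes>\<^bsub>fractions\<^esub> T = P \<otimes>\<^bsub>fractions\<^esub> (Q \<otimes>\<^bsub>fractions\<^esub> T)"
      using as cl by (simp add: eqs frac_mult m_assoc)
    show "P \<otimes>\<^bsub>fractions\<^esub> Q = Q \<otimes>\<^bsub>fractions\<^esub> P"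
      using as cl by (simp add: eqs frac_mult m_comm)
    show "\<one>\<^bsub>fractions\<^esub> \<otimes>\<^bsub>fractions\<^esub> P = P"
      using as cl by (simp add: eqs fractions_one frac_mult)
  qed (simp add: fractions_one)
  fix P Q T assume P: "P \<in> carrier fractions" and Q: "Q \<in> carrier fractions" and T: "T \<in> carrier fractions"
  from P obtain a s where P: "a \<in> carrier R" "s \<in> regular" "P = frac a s" by (rule fractions_cases)
  from Q obtain b u where Q: "b \<in> carrier R" "u \<in> regular" "Q = frac b u" by (rule fractions_cases)
  from T obtain c v where T: "c \<in> carrier R" "v \<in> regular" "T = frac c v" by (rule fractions_cases)
  have cl: "s \<in> carrier R" "u \<in> carrier R" "v \<in> carrier R" using P Q T by auto
  note eqs = P(3) Q(3) T(3) and as = P(1,2) Q(1,2) T(1,2)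
  \<comment> \<open>The two sides of distributivity come with the different denominators
    \<open>(s u) v\<close> and \<open>(s v) (u v)\<close>, so they are compared by
    cross-multiplication.\<close>
  have "((a \<otimes> u \<oplus> b \<otimes> s) \<otimes> c) \<otimes> ((s \<otimes> v) \<otimes> (u \<otimes> v)) =
      ((a \<otimes> c) \<otimes> (u \<otimes> v) \<oplus> (b \<otimes> c) \<otimes> (s \<otimes> v)) \<otimes> ((s \<otimes> u) \<otimes> v)"
    using P(1) Q(1) T(1) cl by algebra
  then show "(P \<oplus>\<^bsub>fractions\<^esub> Q) \<otimes>\<^bsub>fractions\<^esub> T = P \<otimes>\<^bsub>fractions\<^esub> T \<oplus>\<^bsub>fractions\<^esub> Q \<otimes>\<^bsub>fractions\<^esub> T"
    using as cl by (simp add: eqs frac_add frac_mult) (rule frac_eqI; simp)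
qed

sublocale F: cring fractions by (rule fractions_cring)

section \<open>The group action on fractions\<close>

definition fractions_action :: "'g \<Rightarrow> ('b \<times> 'b) set \<Rightarrow> ('b \<times> 'b) set" where
  "fractions_action g = (\<lambda>P\<in>carrier fractions. \<Union>(a, s)\<in>P. frac (\<phi> g a) (\<phi> g s))"

text \<open>For another representative \<open>(b, u)\<close>, the cross difference of the translated
  pairs is the translate of \<open>a u - b s\<close>, hence in \<open>N\<close> by stability.
  \<open>regular_act\<close> keeps the denominators admissible.\<close>

lemma fractions_action_frac:
  assumes g: "g \<in> carrier G" and as: "a \<in> carrier R" "s \<in> regular"
  shows "fractions_action g (frac a s) = frac (\<phi> g a) (\<phi> g s)"
proof -
  interpret hom: ring_hom_cring R R "\<phi> g"
    using act(1)[OF g] by unfold_locales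
  have eq: "frac (\<phi> g b) (\<phi> g u) = frac (\<phi> g a) (\<phi> g s)" if "(b, u) \<in> frac a s" for b u
  proof -
    note m = frac_memD[OF that]
    have "\<phi> g a \<otimes> \<phi> g u \<ominus> \<phi> g b \<otimes> \<phi> g s = \<phi> g (a \<otimes> u \<ominus> b \<otimes> s)"
      using m as by (simp add: minus_eq)
    then show ?thesis
      using act_N[OF g m(3)] m as g
      by (subst eq_commute) (simp add: frac_eq_iff regular_act)
  qed
  have "(\<Union>(b, u)\<in>frac a s. frac (\<phi> g b) (\<phi> g u)) = frac (\<phi> g a) (\<phi> g s)"
  proof (rule SUP_eq_const)
    show "(case p of (b, u) \<Rightarrow> frac (\<phi> g b) (\<phi> g u)) = frac (\<phi> g a) (\<phi> g s)" if "p \<in> frac a s" for p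
      using eq[of "fst p" "snd p"] that by (simp only: prod.collapse case_prod_beta)
  qed (use frac_self[OF as] in blast)
  then show ?thesis
    using frac_closed[OF as] by (simp only: fractions_action_def restrict_apply')
qed

lemma fractions_difference_ring: "difference_ring G fractions fractions_action"
proof (rule difference_ringI[OF G.group_axioms fractions_cring])
  fix g assume g: "g \<in> carrier G"
  note acts = fractions_action_frac[OF g] regular_act[OF g] act(2)[OF g]
  interpret hom: ring_hom_cring R R "\<phi> g"
    using act(1)[OF g] by unfold_locales
  show "fractions_action g \<in> ring_hom fractions fractions"
  proof (rule ring_hom_memI)
    fix P Q assume P: "P \<in> carrier fractions" and Q: "Q \<in> carrier fractions"
    from P obtain a s where P: "a \<in> carrier R" "s \<in> regular" "P = frac a s" by (rule fractions_cases)
    from Q obtain b u where Q: "b \<in> carrier R" "u \<in> regular" "Q = frac b u" by (rule fractions_cases)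
    show "fractions_action g P \<in> carrier fractions"
      using P by (simp add: acts)
    show "fractions_action g (P \<otimes>\<^bsub>fractions\<^esub> Q) = fractions_action g P \<otimes>\<^bsub>fractions\<^esub> fractions_action g Q"
      using P Q by (simp add: acts frac_mult)
    show "fractions_action g (P \<oplus>\<^bsub>fractions\<^esub> Q) = fractions_action g P \<oplus>\<^bsub>fractions\<^esub> fractions_action g Q"
      using P Q by (simp add: acts frac_add)
  qed (simp add: fractions_one acts)
  show "fractions_action g \<in> extensional (carrier fractions)"
    by (simp add: fractions_action_def)
next
  fix P assume P: "P \<in> carrier fractions"
  then obtain a s where P: "a \<in> carrier R" "s \<in> regular" "P = frac a s" by (rule fractions_cases)
  show "fractions_action \<one>\<^bsub>G\<^esub> P = P" using P by (simp add: fractions_action_frac act(3))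
  fix g h assume gh: "g \<in> carrier G" "h \<in> carrier G"
  show "fractions_action (g \<otimes>\<^bsub>G\<^esub> h) P = fractions_action g (fractions_action h P)"
    using P gh by (simp add: fractions_action_frac regular_act act(2,4))
qed

section \<open>Perfectness of the zero ideal of the ring of fractions\<close>

lemma frac_eq_zero_iff:
  assumes "a \<in> carrier R" "s \<in> regular"
  shows "frac a s = \<zero>\<^bsub>fractions\<^esub> \<longleftrightarrow> a \<in> N"
  using assms by (simp add: fractions_zero frac_eq_iff minus_eq)

text \<open>Regularity of the denominator is part of the claim because the induction step needs it
  for \<open>frac_mult\<close>; \<open>frac_finprod\<close> has the same form for the same
  reason.\<close>

lemma frac_pow:
  fixes k :: nat
  assumes "a \<in> carrier R" "s \<in> regular"
  shows "frac a s [^]\<^bsub>fractions\<^esub> k = frac (a [^] k) (s [^] k) \<and> s [^] k \<in> regular"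
  using assms by (induction k) (simp_all add: fractions_one frac_mult)

lemma frac_finprod:
  assumes "finite A" "\<And>i. i \<in> A \<Longrightarrow> a i \<in> carrier R" "\<And>i. i \<in> A \<Longrightarrow> s i \<in> regular"
  shows "(\<Otimes>\<^bsub>fractions\<^esub>i\<in>A. frac (a i) (s i)) = frac (\<Otimes>i\<in>A. a i) (\<Otimes>i\<in>A. s i) \<and> (\<Otimes>i\<in>A. s i) \<in> regular"
  using assms
proof (induction A rule: finite_induct)
  case empty
  then show ?case by (simp add: fractions_one)
next
  case (insert x A)
  then show ?case by (simp add: F.finprod_insert finprod_insert Pi_def frac_mult)
qed

text \<open>A product of powers of translates of \<open>a/s\<close> has as numerator the same
  product formed from \<open>a\<close>, and a fraction vanishes exactly when its numerator lies in
  \<open>N\<close>. So the claim reduces to perfectness of \<open>N\<close>.\<close>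

lemma fractions_zero_perfect: "perfect_difference_ideal G fractions fractions_action {\<zero>\<^bsub>fractions\<^esub>}"
proof (rule perfect_difference_idealI[OF F.zeroideal])
  fix g P assume "g \<in> carrier G" "P \<in> {\<zero>\<^bsub>fractions\<^esub>}"
  then show "fractions_action g P \<in> {\<zero>\<^bsub>fractions\<^esub>}"
    using ring_hom_zero[OF difference_ringD(3)[OF fractions_difference_ring] F.ring_axioms F.ring_axioms]
    by simp
next
  fix P r \<tau> and k :: "nat \<Rightarrow> nat"
  assume P: "P \<in> carrier fractions" and r: "1 \<le> r" and \<tau>: "\<And>i. i \<in> {1..r} \<Longrightarrow> \<tau> i \<in> carrier G \<and> 0 < k i"
    and zero: "(\<Otimes>\<^bsub>fractions\<^esub>i\<in>{1..r}. fractions_action (\<tau> i) P [^]\<^bsub>fractions\<^esub> k i) \<in> {\<zero>\<^bsub>fractions\<^esub>}"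
  from P obtain a s where P: "a \<in> carrier R" "s \<in> regular" "P = frac a s" by (rule fractions_cases)
  let ?a = "\<lambda>i. \<phi> (\<tau> i) a [^] k i" and ?s = "\<lambda>i. \<phi> (\<tau> i) s [^] k i"
  have cl: "\<phi> (\<tau> i) a \<in> carrier R" "\<phi> (\<tau> i) s \<in> regular" if "i \<in> {1..r}" for i
    using P \<tau>[OF that] by (auto simp: act(2) regular_act)
  have as: "?a i \<in> carrier R" "?s i \<in> regular" if "i \<in> {1..r}" for i
    using cl[OF that] frac_pow by auto
  have "(\<Otimes>\<^bsub>fractions\<^esub>i\<in>{1..r}. fractions_action (\<tau> i) P [^]\<^bsub>fractions\<^esub> k i) =
      (\<Otimes>\<^bsub>fractions\<^esub>i\<in>{1..r}. frac (?a i) (?s i))"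
    using as cl \<tau> P by (intro F.finprod_cong') (auto simp: fractions_action_frac frac_pow)
  also have "\<dots> = frac (finprod R ?a {1..r}) (finprod R ?s {1..r})"
    using frac_finprod[of "{1..r}" ?a ?s] as by simp
  finally have "finprod R ?a {1..r} \<in> N"
    using zero frac_eq_zero_iff frac_finprod[of "{1..r}" ?a ?s] as by (simp add: finprod_closed Pi_def)
  then have "a \<in> N"
    by (rule perfect_difference_idealD[OF perfect P(1) r, rotated]) (use \<tau> in blast)
  then show "P \<in> {\<zero>\<^bsub>fractions\<^esub>}" using P frac_eq_zero_iff by simp
qed

section \<open>The canonical homomorphism into the ring of fractions\<close>

abbreviation to_fractions :: "'b \<Rightarrow> ('b \<times> 'b) set" where
  "to_fractions a \<equiv> frac a \<one>"

lemma to_fractions_hom: "to_fractions \<in> ring_hom R fractions"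
  by (rule ring_hom_memI) (simp_all add: frac_mult frac_add fractions_one)

lemma to_fractions_action:
  assumes "g \<in> carrier G" "a \<in> carrier R"
  shows "to_fractions (\<phi> g a) = fractions_action g (to_fractions a)"
  using assms ring_hom_one[OF act(1)] by (simp add: fractions_action_frac)

lemma to_fractions_mult_inverse:
  assumes "s \<in> regular"
  shows "frac \<one> s \<otimes>\<^bsub>fractions\<^esub> to_fractions s = \<one>\<^bsub>fractions\<^esub>"
  using assms by (simp add: frac_mult fractions_one) (rule frac_eqI; simp)

end
section \<open>Generic points\<close>

text \<open>The indeterminate \<open>y\<close> is the variable indexed by the identity of the group;
  every other variable \<open>g y\<close> is its translate.\<close>

definition dpoly_variable :: "('g, 'm) monoid_scheme \<Rightarrow> 'y \<Rightarrow> ('g, 'y, 'a::comm_ring_1) dpoly" where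
  "dpoly_variable G y = Poly_Mapping.single (Poly_Mapping.single (\<one>\<^bsub>G\<^esub>, y) 1) 1"

lemma dpoly_variable_closed:
  assumes "group G" "y \<in> Y"
  shows "dpoly_variable G y \<in> carrier (dpoly_ring G Y)"
proof -
  interpret group G by fact
  show ?thesis using assms by (simp add: dpoly_variable_def dpoly_closed_single)
qed

lemma (in dpoly_evaluation) ev_variable:
  assumes "y \<in> Y"
  shows "ev (dpoly_variable G y) = b y"
proof -
  have v: "(\<one>\<^bsub>G\<^esub>, y) \<in> carrier G \<times> Y" using assms by simp
  then show ?thesis
    using point[OF assms] difference_ringD(5)[OF B] monomial_eval_single[OF v, of 1]
    by (simp add: dpoly_variable_def ev_single \<iota>)
qed

lemma dpoly_ring_nat_pow: "p [^]\<^bsub>dpoly_ring G Y\<^esub> (k::nat) = p ^ k"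
proof -
  interpret cring "dpoly_ring G Y" by (rule dpoly_ring_cring)
  show ?thesis by (induction k) (simp_all add: dpoly_ring_simps mult.commute)
qed

lemma single_single_power:
  "Poly_Mapping.single (Poly_Mapping.single v 1) 1 ^ k =
     Poly_Mapping.single (Poly_Mapping.single v (k::nat)) (1::'a::comm_ring_1)"
  by (induction k) (simp_all add: mult_single single_add[symmetric])

text \<open>The tuple of indeterminates is a point over the ring of difference polynomials, the
  constants being embedded as coefficients of the empty monomial. This makes the results on
  evaluation available there.\<close>

lemma dpoly_evaluation_generic:
  fixes \<phi> :: "'g \<Rightarrow> 'a::comm_ring_1 \<Rightarrow> 'a"
  assumes A: "difference_ring G ring_of_type_algebra \<phi>"
  shows "dpoly_evaluation G \<phi> (dpoly_ring G Y) (dpoly_action G \<phi> Y) (Poly_Mapping.single 0) Y (dpoly_variable G)"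
proof
  note D = difference_ring_typeD[OF A] and G = difference_ringD(1)[OF A]
  show "difference_ring G (dpoly_ring G Y) (dpoly_action G \<phi> Y)"
    by (rule dpoly_ring_difference_ring[OF A])
  show "Poly_Mapping.single 0 \<in> ring_hom ring_of_type_algebra (dpoly_ring G Y)"
    by (rule ring_hom_memI)
      (auto simp: dpoly_closed_single ring_of_type_algebra_simps dpoly_ring_simps(2-) single_add mult_single)
  show "Poly_Mapping.single 0 (\<phi> g a) = dpoly_action G \<phi> Y g (Poly_Mapping.single 0 a)" if "g \<in> carrier G" for g a
    using D(4)[OF that] by (simp add: dpoly_action_single shift_monomial_0)
  show "dpoly_variable G y \<in> carrier (dpoly_ring G Y)" if "y \<in> Y" for y
    using dpoly_variable_closed[OF G that] .
qed (rule A)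

text \<open>Together with \<open>ev_transfer\<close>, this identifies an equivariant homomorphism on
  the polynomial ring with evaluation at the images of the indeterminates.\<close>

lemma dpoly_eval_generic:
  fixes \<phi> :: "'g \<Rightarrow> 'a::comm_ring_1 \<Rightarrow> 'a"
  assumes A: "difference_ring G ring_of_type_algebra \<phi>" and p: "p \<in> carrier (dpoly_ring G Y)"
  shows "dpoly_eval (dpoly_ring G Y) (dpoly_action G \<phi> Y) (Poly_Mapping.single 0) (dpoly_variable G) p = p"
proof -
  note D = difference_ring_typeD[OF A]
  interpret dpoly_evaluation G \<phi> "dpoly_ring G Y" "dpoly_action G \<phi> Y" "Poly_Mapping.single 0" Y "dpoly_variable G"
    by (rule dpoly_evaluation_generic[OF A])
  have mon: "monomial_eval (dpoly_ring G Y) (dpoly_action G \<phi> Y) (dpoly_variable G) m = Poly_Mapping.single m (1::'a)"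
    if "m \<in> monomials G Y" for m
  proof -
    have "Poly_Mapping.keys m \<subseteq> carrier G \<times> Y" using that by simp
    then show ?thesis
    proof (induction m rule: poly_mapping_induct)
      case zero
      then show ?case by (simp add: monomial_eval_0 dpoly_ring_simps)
    next
      case (single v k)
      have "dpoly_action G \<phi> Y (fst v) (dpoly_variable G (snd v)) =
          Poly_Mapping.single (Poly_Mapping.single v 1) (1::'a)"
        using single D(3,4)[of "fst v"] unfolding dpoly_variable_def
        by (subst dpoly_action_single) (auto simp: shift_monomial_single)
      then show ?case
        by (simp add: monomial_eval_single[OF single] dpoly_ring_nat_pow single_single_power[simplified])
    next
      case (add m m')
      then show ?case by (simp add: monomial_eval_add dpoly_ring_simps mult_single)
    qed
  qed
  have "Poly_Mapping.keys p \<subseteq> monomials G Y" using p by (simp add: dpoly_ring_simps)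
  then show ?thesis
  proof (induction p rule: poly_mapping_induct)
    case zero
    then show ?case by (simp add: ev_0 dpoly_ring_simps)
  next
    case (single m c)
    then show ?case using mon by (simp add: ev_single dpoly_ring_simps mult_single)
  next
    case (add p q)
    then show ?case using ev_add[of p q] by (simp add: dpoly_ring_simps)
  qed
qed

text \<open>Polynomials over different sets of indeterminates share one type, so adjoining a
  variable only enlarges the carrier and needs no embedding map.\<close>

lemma dpoly_ring_mono: "Y \<subseteq> Z \<Longrightarrow> carrier (dpoly_ring G Y) \<subseteq> carrier (dpoly_ring G Z)"
  by (fastforce simp: dpoly_ring_simps)

section \<open>The Nullstellensatz\<close>

theorem theorem14:
  fixes G :: "('g, 'm) monoid_scheme"
    and \<phi> :: "'g \<Rightarrow> 'k::field \<Rightarrow> 'k"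
    and n :: nat
    and \<tt> :: "('g, nat, 'k) dpoly set"
  assumes "group G"
    and "difference_closed_field G \<phi>"
    and "perfect_difference_ideal G (dpoly_ring G {1..n}) (dpoly_action G \<phi> {1..n}) \<tt>"
  shows "\<tt> = vanishing_ideal G \<phi> {1..n} (zero_set \<phi> {1..n} \<tt>)"
proof (rule equalityI; rule subsetI)
  let ?P = "dpoly_ring G {1..n} :: ('g, nat, 'k) dpoly ring"
    and ?P' = "dpoly_ring G {1..Suc n} :: ('g, nat, 'k) dpoly ring"
  let ?A = "dpoly_action G \<phi> {1..n}" and ?A' = "dpoly_action G \<phi> {1..Suc n}"
  let ?ev = "dpoly_eval ring_of_type_algebra \<phi> id"
  have K: "difference_ring G (ring_of_type_algebra :: 'k ring) \<phi>" and B1: "difference_closed_B1 G \<phi>"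
    using assms(2) by (auto simp: difference_closed_field_def)
  have PA: "difference_ring G ?P ?A" and PA': "difference_ring G ?P' ?A'"
    by (rule dpoly_ring_difference_ring[OF K])+
  interpret t: ideal \<tt> ?P
    using assms(3) by (simp add: perfect_difference_ideal_def difference_ideal_def)
  have t_carrier: "p \<in> carrier ?P" if "p \<in> \<tt>" for p using that by (rule t.Icarr)
  show "p \<in> vanishing_ideal G \<phi> {1..n} (zero_set \<phi> {1..n} \<tt>)" if "p \<in> \<tt>" for p
    using that t_carrier
    by (auto simp: vanishing_ideal_def zero_set_def common_zeros_def ring_of_type_algebra_simps)
  fix f assume "f \<in> vanishing_ideal G \<phi> {1..n} (zero_set \<phi> {1..n} \<tt>)"
  then have f: "f \<in> carrier ?P" and f_zero: "\<And>c. c \<in> zero_set \<phi> {1..n} \<tt> \<Longrightarrow> ?ev c f = 0"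
    by (auto simp: vanishing_ideal_def)
  show "f \<in> \<tt>"
  proof (rule ccontr)
    assume f_t: "f \<notin> \<tt>"
    define N where "N = {a \<in> carrier ?P. f \<otimes>\<^bsub>?P\<^esub> a \<in> \<tt>}"
    interpret Q: perfect_quotient G ?P ?A N
      using PA perfect_difference_ideal_colon[OF PA assms(3) f] unfolding N_def by unfold_locales
    have f_reg: "f \<in> Q.regular"
    proof (rule Q.regularI[OF f])
      fix a assume "a \<in> carrier ?P" "f \<otimes>\<^bsub>?P\<^esub> a \<in> N"
      then show "a \<in> N"
        using perfect_difference_ideal_colon_cancel[OF PA assms(3) f, of a] unfolding N_def by blast
    qed
    let ?B = "Q.fractions"
    let ?\<iota> = "\<lambda>c. Q.to_fractions (Poly_Mapping.single 0 c)"
    \<comment> \<open>The index \<open>Suc n\<close> lies outside \<open>{1..n}\<close>, so for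
      polynomials in the old variables this point is the image of the generic point.\<close>
    let ?b = "\<lambda>y. if y = Suc n then Q.frac 1 f else Q.to_fractions (dpoly_variable G y)"
    interpret E0: dpoly_evaluation G \<phi> ?P ?A "Poly_Mapping.single 0" "{1..n}" "dpoly_variable G"
      by (rule dpoly_evaluation_generic[OF K])
    interpret E: dpoly_evaluation G \<phi> ?B Q.fractions_action ?\<iota> "{1..Suc n}" ?b
    proof
      show "?\<iota> \<in> ring_hom ring_of_type_algebra ?B"
        using ring_hom_trans[OF E0.hom Q.to_fractions_hom] by (simp add: comp_def)
      show "?\<iota> (\<phi> g a) = Q.fractions_action g (?\<iota> a)" if "g \<in> carrier G" for g a
        using Q.to_fractions_action[OF that E0.\<iota>(1)] by (simp only: E0.equiv[OF that])
      show "?b y \<in> carrier ?B" if "y \<in> {1..Suc n}" for y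
      proof (cases "y = Suc n")
        case True
        then show ?thesis using Q.frac_closed[OF dpoly_closed_0_1(2) f_reg] by simp
      next
        case False
        then have "y \<in> {1..n}" using that by auto
        then show ?thesis using Q.frac_closed[OF E0.point Q.regular_one] False by simp
      qed
    qed (use K Q.fractions_difference_ring in auto)
    \<comment> \<open>This transfers the generic evaluation, which is the identity, along the
      canonical map.\<close>
    have ev_P: "E.ev p = Q.to_fractions p" if "p \<in> carrier ?P" for p
      using E0.ev_transfer[OF Q.fractions_difference_ring Q.to_fractions_hom Q.to_fractions_action, of ?b p]
        that by (simp add: dpoly_eval_generic[OF K])
    \<comment> \<open>The kernel is written with membership in a singleton to match
      \<open>perfect_difference_ideal_preimage\<close>.\<close>
    define \<aa> where "\<aa> = {p \<in> carrier ?P'. E.ev p \<in> {\<zero>\<^bsub>?B\<^esub>}}"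
    have "perfect_difference_ideal G ?P' ?A' \<aa>"
      unfolding \<aa>_def
      by (rule perfect_difference_ideal_preimage[OF PA' Q.fractions_difference_ring E.ev_ring_hom E.ev_action
            Q.fractions_zero_perfect])
    \<comment> \<open>If 1 were in the kernel, the fraction 1/1 would vanish, so 1 would lie in
      \<open>N\<close>, that is, \<open>f\<close> would lie in \<open>\<tt>\<close>.\<close>
    moreover have "1 \<notin> \<aa>"
    proof -
      have "1 \<notin> N" using f_t by (simp add: N_def dpoly_ring_simps)
      then show ?thesis
        using Q.frac_eq_zero_iff[OF dpoly_closed_0_1(2) Q.regular_one] ev_P[of 1] by (simp add: \<aa>_def dpoly_closed_0_1)
    qed
    ultimately have "zero_set \<phi> {1..Suc n} \<aa> \<noteq> {}"
      using B1 dpoly_closed_0_1(2) unfolding difference_closed_B1_def by blast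
    then obtain c where c: "\<And>p. p \<in> \<aa> \<Longrightarrow> ?ev c p = 0"
      by (auto simp: zero_set_def common_zeros_def ring_of_type_algebra_simps)
    have id_hom: "id \<in> ring_hom ring_of_type_algebra (ring_of_type_algebra :: 'k ring)"
      by (simp add: ring_hom_def)
    interpret C: dpoly_evaluation G \<phi> ring_of_type_algebra \<phi> id "{1..Suc n}" c
      using K id_hom by unfold_locales (auto simp: ring_of_type_algebra_simps)
    interpret C0: dpoly_evaluation G \<phi> ring_of_type_algebra \<phi> id "{1..n}" c
      using K id_hom by unfold_locales (auto simp: ring_of_type_algebra_simps)
    \<comment> \<open>Points of \<open>zero_set\<close> are extensional, so the last coordinate has
      to be reset to \<open>undefined\<close>. Polynomials in the first \<open>n\<close> variables
      do not see the change.\<close>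
    let ?c = "restrict c {1..n}"
    have ev_c: "?ev ?c p = ?ev c p" if "p \<in> carrier ?P" for p
      using C0.ev_transfer[OF K id_hom, of ?c p] that by (simp add: id_def)
    have P_P': "carrier ?P \<subseteq> carrier ?P'" by (rule dpoly_ring_mono) auto
    have "?c \<in> zero_set \<phi> {1..n} \<tt>"
    proof -
      have "?ev ?c p = 0" if p: "p \<in> \<tt>" for p
      proof -
        \<comment> \<open>Since \<open>\<tt>\<close> is an ideal, it is contained in its quotient by
          \<open>f\<close>; elements of \<open>\<tt>\<close> therefore become zero in the ring of
          fractions.\<close>
        have "p \<in> N" using p f t_carrier t.I_l_closed by (simp add: N_def)
        then have "p \<in> \<aa>"
          using t_carrier[OF p] P_P' ev_P Q.frac_eq_zero_iff[OF _ Q.regular_one, of p]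
          by (auto simp: \<aa>_def)
        then show ?thesis using c ev_c[OF t_carrier[OF p]] by simp
      qed
      then show ?thesis by (auto simp: zero_set_def common_zeros_def ring_of_type_algebra_simps)
    qed
    then have cf: "?ev c f = 0" using f_zero[of ?c] ev_c[OF f] by simp
    let ?z = "dpoly_variable G (Suc n) :: ('g, nat, 'k) dpoly"
    define q where "q = ?z * f - 1"
    have z: "?z \<in> carrier ?P'" by (rule dpoly_variable_closed[OF assms(1)]) simp
    have f': "f \<in> carrier ?P'" using f P_P' by blast
    have q: "q \<in> carrier ?P'"
      using dpoly_closed_add[OF dpoly_closed_mult[OF z f'] dpoly_closed_uminus[OF dpoly_closed_0_1(2)]]
      by (simp add: q_def)
    \<comment> \<open>Writing the relation without subtraction lets both evaluations be computed
      from \<open>ev_add\<close> and \<open>ev_1\<close>.\<close>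
    have zf: "?z * f = q + 1" by (simp add: q_def)
    have "E.ev q \<oplus>\<^bsub>?B\<^esub> \<one>\<^bsub>?B\<^esub> = E.ev (?z * f)"
      unfolding zf using E.ev_add[OF q dpoly_closed_0_1(2)] E.ev_1 by simp
    also have "\<dots> = Q.frac \<one>\<^bsub>?P\<^esub> f \<otimes>\<^bsub>?B\<^esub> Q.to_fractions f"
      using E.ev_mult[OF z f'] E.ev_variable[of "Suc n"] ev_P[OF f] by (simp add: dpoly_ring_simps)
    also have "\<dots> = \<one>\<^bsub>?B\<^esub>" by (rule Q.to_fractions_mult_inverse[OF f_reg])
    finally have "E.ev q = \<zero>\<^bsub>?B\<^esub>"
      by (simp only: Q.F.add.r_cancel_one[OF Q.F.one_closed E.ev_closed[OF q]])
    then have "?ev c q = 0" using c q by (simp add: \<aa>_def)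
    then have "?ev c (?z * f) = 1"
      unfolding zf using C.ev_add[OF q dpoly_closed_0_1(2)] C.ev_1 by (simp add: ring_of_type_algebra_simps)
    \<comment> \<open>At \<open>c\<close> the product \<open>?z * f\<close> has the value 1, while
      its factor \<open>f\<close> vanishes there.\<close>
    then show False
      using C.ev_mult[OF z f'] cf by (simp add: ring_of_type_algebra_simps)
  qed
qed

end
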